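(* Let $n\ge1$, $0<\mu_1\le\dots\le\mu_n$ and $1\le p<\infty$. Let $\tilde X=\mathbb{R}_+\times\mathbb{R}^n$ with the metric $dt^2+\sum_i e^{2\mu_i t}dx_i^2$, and let $X=\tilde X/\Gamma$, where $\Gamma$ is a lattice of translations in the factor $\mathbb{R}^n$. Then the Poincaré constant $C_p(\mu)$ for a ball $B(R)$ in $X$ satisfies $$C_p(\mu)\le\frac p\mu+(A(\mu))^{1/p}\,C_p(\mathbb{T}^n)\,e^{\mu_n R},$$ where $\mu=\sum_i\mu_i$, $A(\mu)$ is a constant depending only on $\mu_1,\dots,\mu_n$, and $C_p(\mathbb{T}^n)$ is a Poincaré constant for the torus $\mathbb{T}^n$.
   Context: For a Riemannian manifold $M$, the Poincaré constant $C_p(M)$ is the best constant $C$ such that for any real valued function $f$ on $M$ there is a real number $m_f$ with $\|f-m_f\|_p\le C\|\nabla f\|_p$ ($L^p$-norms with respect to the Riemannian volume). Here $\mathbb{T}^n=\mathbb{R}^n/\Gamma$ carries the Euclidean metric $\sum_i dx_i^2$. The ball of radius $R$ in $X$ is $B(R)=\{(t,\theta):0\le t\le R,\ \theta\in\mathbb{T}^n\}$, with volume element $e^{\mu t}\,dt\,d\theta$. *)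

theory Defs
  imports "HOL-Analysis.Analysis"
begin

section \<open>Riemannian quotients by translations\<close>

text \<open>
  A Riemannian manifold (possibly with boundary) of the form \<open>D / \<Gamma>\<close>, where \<open>D\<close> (\<open>cover\<close>) is a
  subset of a Euclidean space, \<open>\<Gamma>\<close> (\<open>deck\<close>) is a group of translations preserving \<open>D\<close>,
  and the \<open>\<Gamma>\<close>-invariant metric is given as \<open>rmetric x v w = \<langle>v, w\<rangle>\<^sub>x\<close>.
  Functions on the quotient are \<open>\<Gamma>\<close>-periodic functions on \<open>D\<close>, and integrals over the quotient are
  integrals over a fundamental domain (\<open>fdom\<close>) of \<open>\<Gamma>\<close> in \<open>D\<close>.
\<close>

record 'a riem_quot =
  cover :: "'a set"
  deck :: "'a set"
  fdom :: "'a set"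
  rmetric :: "'a \<Rightarrow> 'a \<Rightarrow> 'a \<Rightarrow> real"

text \<open>The square root of the Gram determinant of the standard basis (Leibniz formula).\<close>

definition vol_density :: "'a::euclidean_space riem_quot \<Rightarrow> 'a \<Rightarrow> real" where
  "vol_density M x =
     sqrt (\<Sum>\<sigma> | \<sigma> permutes (Basis :: 'a set). of_int (sign \<sigma>) * (\<Prod>b\<in>Basis. rmetric M x b (\<sigma> b)))"

definition riem_grad :: "'a::euclidean_space riem_quot \<Rightarrow> ('a \<Rightarrow> real) \<Rightarrow> 'a \<Rightarrow> 'a" where
  "riem_grad M f x =
     (THE w. \<forall>v. rmetric M x w v = frechet_derivative f (at x within cover M) v)"

definition grad_norm :: "'a::euclidean_space riem_quot \<Rightarrow> ('a \<Rightarrow> real) \<Rightarrow> 'a \<Rightarrow> real" where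
  "grad_norm M f x = sqrt (rmetric M x (riem_grad M f x) (riem_grad M f x))"

text \<open>\<open>C\<^sup>1\<close> functions on the quotient, up to the boundary of \<open>D\<close>.\<close>

definition C1_fun :: "'a::euclidean_space riem_quot \<Rightarrow> ('a \<Rightarrow> real) \<Rightarrow> bool" where
  "C1_fun M f \<longleftrightarrow>
     (\<forall>x\<in>cover M. \<forall>\<gamma>\<in>deck M. f (x + \<gamma>) = f x) \<and>
     (\<exists>f' :: 'a \<Rightarrow> 'a \<Rightarrow>\<^sub>L real. continuous_on (cover M) f' \<and>
        (\<forall>x\<in>cover M. (f has_derivative blinfun_apply (f' x)) (at x within cover M)))"

definition Lp_norm :: "real \<Rightarrow> 'a::euclidean_space riem_quot \<Rightarrow> ('a \<Rightarrow> real) \<Rightarrow> ennreal" where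
  "Lp_norm p M h =
     (let I = (\<integral>\<^sup>+x\<in>fdom M. ennreal (\<bar>h x\<bar> powr p * vol_density M x) \<partial>lborel)
      in if I = \<infinity> then \<infinity> else ennreal (enn2real I powr (1 / p)))"

text \<open>The best constant, with value \<open>\<infinity>\<close> if no finite constant works.\<close>

definition poincare_const :: "real \<Rightarrow> 'a::euclidean_space riem_quot \<Rightarrow> ennreal" where
  "poincare_const p M =
     Inf {C. \<forall>f. C1_fun M f \<longrightarrow>
            (\<exists>m::real. Lp_norm p M (\<lambda>x. f x - m) \<le> C * Lp_norm p M (grad_norm M f))}"


section \<open>Lattices\<close>

definition lattice_in :: "(real ^ 'n) set \<Rightarrow> bool" where
  "lattice_in \<Gamma> \<longleftrightarrow>
     (\<exists>B. independent B \<and> span B = UNIV \<and>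
          \<Gamma> = range (\<lambda>k :: real ^ 'n \<Rightarrow> int. \<Sum>b\<in>B. of_int (k b) *\<^sub>R b))"

definition fundamental_domain :: "(real ^ 'n) set \<Rightarrow> (real ^ 'n) set \<Rightarrow> bool" where
  "fundamental_domain \<Gamma> F \<longleftrightarrow> F \<in> sets borel \<and> (\<forall>x. \<exists>!\<gamma>. \<gamma> \<in> \<Gamma> \<and> x + \<gamma> \<in> F)"


section \<open>The torus, the space \<open>X\<close> and its balls\<close>

definition torus :: "(real ^ 'n) set \<Rightarrow> (real ^ 'n) set \<Rightarrow> (real ^ 'n) riem_quot" where
  "torus \<Gamma> F = \<lparr>cover = UNIV, deck = \<Gamma>, fdom = F, rmetric = (\<lambda>x v w. v \<bullet> w)\<rparr>"

text \<open>\<open>X = (\<real>\<^sub>+ \<times> \<real>\<^sup>n) / \<Gamma>\<close> with the metric \<open>dt\<^sup>2 + \<Sum>\<^sub>i e\<^bsup>2 \<mu>\<^sub>i t\<^esup> dx\<^sub>i\<^sup>2\<close>.\<close>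

definition space_X ::
    "('n \<Rightarrow> real) \<Rightarrow> (real ^ 'n) set \<Rightarrow> (real ^ 'n) set \<Rightarrow> (real \<times> (real ^ 'n)) riem_quot" where
  "space_X \<mu> \<Gamma> F =
     \<lparr>cover = {0..} \<times> UNIV, deck = {0} \<times> \<Gamma>, fdom = {0..} \<times> F,
      rmetric = (\<lambda>(t, x) (a, v) (b, w). a * b + (\<Sum>i\<in>UNIV. exp (2 * \<mu> i * t) * (v $ i) * (w $ i)))\<rparr>"

definition ball_X ::
    "('n \<Rightarrow> real) \<Rightarrow> (real ^ 'n) set \<Rightarrow> (real ^ 'n) set \<Rightarrow> real \<Rightarrow> (real \<times> (real ^ 'n)) riem_quot" where
  "ball_X \<mu> \<Gamma> F R =
     (space_X \<mu> \<Gamma> F)\<lparr>cover := {0..R} \<times> UNIV, fdom := {0..R} \<times> F\<rparr>"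


section \<open>Sanity checks\<close>

lemma vol_density_diagonal:
  fixes M :: "'a::euclidean_space riem_quot"
  assumes "\<And>b c. b \<in> Basis \<Longrightarrow> c \<in> Basis \<Longrightarrow> b \<noteq> c \<Longrightarrow> rmetric M x b c = 0"
  shows "vol_density M x = sqrt (\<Prod>b\<in>Basis. rmetric M x b b)"
proof -
  have "(\<Sum>\<sigma> | \<sigma> permutes (Basis :: 'a set). of_int (sign \<sigma>) * (\<Prod>b\<in>Basis. rmetric M x b (\<sigma> b)))
      = (\<Sum>\<sigma>\<in>{id}. of_int (sign \<sigma>) * (\<Prod>b\<in>(Basis :: 'a set). rmetric M x b (\<sigma> b)))"
  proof (rule sum.mono_neutral_right)
    show "finite {\<sigma>. \<sigma> permutes (Basis :: 'a set)}"
      by (simp add: finite_permutations)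
    show "{id} \<subseteq> {\<sigma>. \<sigma> permutes (Basis :: 'a set)}"
      by (simp add: permutes_id)
    show "\<forall>\<sigma>\<in>{\<sigma>. \<sigma> permutes (Basis :: 'a set)} - {id}.
        of_int (sign \<sigma>) * (\<Prod>b\<in>Basis. rmetric M x b (\<sigma> b)) = 0"
    proof
      fix \<sigma> assume "\<sigma> \<in> {\<sigma>. \<sigma> permutes (Basis :: 'a set)} - {id}"
      then have \<sigma>: "\<sigma> permutes Basis" and "\<sigma> \<noteq> id" by auto
      then obtain b where b: "\<sigma> b \<noteq> b" by (auto simp: fun_eq_iff)
      with \<sigma> have bB: "b \<in> Basis" by (auto simp: permutes_def)
      with \<sigma> have "\<sigma> b \<in> Basis" by (simp add: permutes_in_image)
      with b bB have "rmetric M x b (\<sigma> b) = 0" by (metis assms)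
      with bB have "(\<Prod>b\<in>Basis. rmetric M x b (\<sigma> b)) = 0"
        by (metis finite_Basis prod_zero)
      then show "of_int (sign \<sigma>) * (\<Prod>b\<in>Basis. rmetric M x b (\<sigma> b)) = 0" by simp
    qed
  qed
  then show ?thesis by (simp add: vol_density_def)
qed

lemma vol_density_torus: "vol_density (torus \<Gamma> F) x = 1"
  by (subst vol_density_diagonal) (auto simp: torus_def inner_Basis)

lemma vol_density_ball_X:
  "vol_density (ball_X \<mu> \<Gamma> F R) (t, x) = exp ((\<Sum>i\<in>UNIV. \<mu> i) * t)"
proof -
  let ?M = "ball_X \<mu> \<Gamma> F R"
  have m: "rmetric ?M (t, x) (a, v) (b, w) =
      a * b + (\<Sum>i\<in>UNIV. exp (2 * \<mu> i * t) * (v $ i) * (w $ i))" for a b v w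
    by (simp add: ball_X_def space_X_def)
  have ax: "(\<Sum>i\<in>UNIV. exp (2 * \<mu> i * t) * (axis j 1 $ i) * (axis k 1 $ i))
      = (if j = k then exp (2 * \<mu> j * t) else 0)" for j k
    by (simp add: axis_def if_distrib[of "\<lambda>z. _ * z"] cong: if_cong)
  have B: "(Basis :: (real \<times> (real ^ 'n)) set) = insert (1, 0) ((\<lambda>i. (0, axis i 1)) ` UNIV)"
    by (auto simp: Basis_prod_def Basis_vec_def)
  have inj: "inj (\<lambda>i. (0::real, axis i (1::real) :: real ^ 'n))"
    by (auto simp: inj_def axis_eq_axis)
  have "vol_density ?M (t, x) = sqrt (\<Prod>b\<in>Basis. rmetric ?M (t, x) b b)"
    by (rule vol_density_diagonal) (auto simp: B m ax split: if_splits)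
  also have "(\<Prod>b\<in>Basis. rmetric ?M (t, x) b b) = (\<Prod>i\<in>UNIV. exp (2 * \<mu> i * t))"
  proof -
    have "(1::real, 0 :: real ^ 'n) \<notin> (\<lambda>i. (0, axis i 1)) ` UNIV" by auto
    then have "(\<Prod>b\<in>Basis. rmetric ?M (t, x) b b) = rmetric ?M (t, x) (1, 0) (1, 0) *
        (\<Prod>b\<in>(\<lambda>i. (0, axis i 1)) ` UNIV. rmetric ?M (t, x) b b)"
      unfolding B by (intro prod.insert) auto
    also have "\<dots> = (\<Prod>i\<in>UNIV. exp (2 * \<mu> i * t))"
      unfolding prod.reindex[OF inj] by (simp add: m ax)
    finally show ?thesis .
  qed
  also have "\<dots> = (exp ((\<Sum>i\<in>UNIV. \<mu> i) * t))\<^sup>2"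
    by (simp add: exp_sum[symmetric] exp_double[symmetric] sum_distrib_left sum_distrib_right mult.assoc)
  finally show ?thesis by simp
qed

lemma riem_grad_torus:
  assumes "f differentiable at x"
  shows "riem_grad (torus \<Gamma> F) f x = (\<Sum>b\<in>Basis. frechet_derivative f (at x) b *\<^sub>R b)"
proof -
  interpret D: bounded_linear "frechet_derivative f (at x)"
    using assms by (simp add: frechet_derivative_works has_derivative_bounded_linear)
  let ?w = "\<Sum>b\<in>Basis. frechet_derivative f (at x) b *\<^sub>R b"
  have *: "?w \<bullet> v = frechet_derivative f (at x) v" for v
  proof -
    have "frechet_derivative f (at x) v = frechet_derivative f (at x) (\<Sum>b\<in>Basis. (v \<bullet> b) *\<^sub>R b)"
      by (simp add: euclidean_representation)
    also have "\<dots> = ?w \<bullet> v"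
      by (simp add: D.sum D.scaleR inner_sum_right inner_commute[of _ v] mult.commute)
    finally show ?thesis by simp
  qed
  show ?thesis
    unfolding riem_grad_def
  proof (rule the_equality)
    fix w assume "\<forall>v. rmetric (torus \<Gamma> F) x w v = frechet_derivative f (at x within cover (torus \<Gamma> F)) v"
    then have "\<forall>v. w \<bullet> v = ?w \<bullet> v" by (simp add: torus_def *)
    then show "w = ?w" by (metis vector_eq_rdot)
  qed (simp add: torus_def *)
qed

lemma lattice_fundamental_domain:
  fixes \<Gamma> :: "(real ^ 'n) set"
  assumes "lattice_in \<Gamma>"
  obtains F where "fundamental_domain \<Gamma> F"
proof -
  obtain B where B: "independent B" "span B = UNIV"
    and \<Gamma>: "\<Gamma> = range (\<lambda>k :: real ^ 'n \<Rightarrow> int. \<Sum>b\<in>B. of_int (k b) *\<^sub>R b)"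
    using assms by (auto simp: lattice_in_def)
  have fin: "finite B" using B(1) by (rule independent_imp_finite)
  define r where "r x b = representation B x b" for x b
  have rep: "x = (\<Sum>b\<in>B. r x b *\<^sub>R b)" for x
    unfolding r_def using sum_representation_eq[OF B(1) _ fin] B(2) by (metis UNIV_I order_refl)
  have lin: "linear (\<lambda>x. r x b)" for b
    unfolding r_def by (rule linearI) (simp_all add: representation_add representation_scale B)
  have r_sum: "r (\<Sum>b\<in>B. c b *\<^sub>R b) b = c b" if "b \<in> B" for c b
  proof -
    have "r (\<Sum>b\<in>B. c b *\<^sub>R b) b = (\<Sum>b'\<in>B. c b' * r b' b)"
      by (simp add: linear_sum[OF lin] linear_scale[OF lin])
    also have "\<dots> = (\<Sum>b'\<in>B. if b' = b then c b' else 0)"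
      by (intro sum.cong) (auto simp: r_def representation_basis[OF B(1)])
    finally show ?thesis using fin that by simp
  qed
  define F where "F = {x. \<forall>b\<in>B. 0 \<le> r x b \<and> r x b < 1}"
  have "F = (\<Inter>b\<in>B. {x. r x b \<in> {0..<1}}) \<inter> UNIV" by (auto simp: F_def)
  also have "\<dots> \<in> sets borel"
  proof -
    have "(\<lambda>x. r x b) \<in> borel_measurable borel" for b
      by (intro borel_measurable_continuous_onI linear_continuous_on linear_conv_bounded_linear[THEN iffD1] lin)
    then have "(\<lambda>x. r x b) -` {0..<1} \<inter> space borel \<in> sets borel" for b
      by (rule measurable_sets) simp
    then show ?thesis using fin by (cases "B = {}") (auto simp: vimage_def)
  qed
  finally have "F \<in> sets borel" .
  moreover have "\<exists>!\<gamma>. \<gamma> \<in> \<Gamma> \<and> x + \<gamma> \<in> F" for x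
  proof (rule ex1I)
    let ?\<gamma> = "\<Sum>b\<in>B. of_int (- \<lfloor>r x b\<rfloor>) *\<^sub>R b"
    have "r (x + ?\<gamma>) b = r x b - \<lfloor>r x b\<rfloor>" if "b \<in> B" for b
      using linear_add[OF lin, of x ?\<gamma>] r_sum[OF that, of "\<lambda>b. of_int (- \<lfloor>r x b\<rfloor>)"] by simp
    then have "x + ?\<gamma> \<in> F" by (auto simp: F_def) linarith
    moreover have "?\<gamma> \<in> \<Gamma>" unfolding \<Gamma> by (rule range_eqI[of _ _ "\<lambda>b. - \<lfloor>r x b\<rfloor>"]) simp
    ultimately show "?\<gamma> \<in> \<Gamma> \<and> x + ?\<gamma> \<in> F" by simp
    fix \<gamma> assume \<gamma>: "\<gamma> \<in> \<Gamma> \<and> x + \<gamma> \<in> F"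
    then obtain k :: "real ^ 'n \<Rightarrow> int" where k: "\<gamma> = (\<Sum>b\<in>B. of_int (k b) *\<^sub>R b)"
      unfolding \<Gamma> by auto
    have "k b = - \<lfloor>r x b\<rfloor>" if "b \<in> B" for b
    proof -
      have "r (x + \<gamma>) b = r x b + k b"
        using linear_add[OF lin, of x \<gamma>] r_sum[OF that, of "\<lambda>b. of_int (k b)"] by (simp add: k)
      with \<gamma> that have "0 \<le> r x b + k b" "r x b + k b < 1" by (auto simp: F_def)
      then show ?thesis by linarith
    qed
    then show "\<gamma> = ?\<gamma>" unfolding k by (intro sum.cong) auto
  qed
  ultimately have "fundamental_domain \<Gamma> F" unfolding fundamental_domain_def by blast
  then show ?thesis by (rule that)
qed

end

theory Submission
  imports Defs
begin

text \<open>
  Let \<open>f\<close> be a \<open>C\<^sup>1\<close> function on the ball, let \<open>\<mu>\<close> be the sum of the \<open>\<mu>\<^sub>i\<close> and \<open>\<mu>\<^sub>n\<close> the largest of them.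
  For every level \<open>r\<close> and every constant \<open>c\<close>,
  \<open>f(t, \<theta>) - c = (f(t, \<theta>) - f(r, \<theta>)) + (f(r, \<theta>) - c)\<close>,
  and the two terms of the bound estimate the two summands.

  The first summand vanishes for \<open>t = r\<close>. If \<open>r = R\<close>, then on each line \<open>\<theta> = const\<close> the Hardy inequality
  for the weight \<open>e\<^bsup>\<mu> t\<^esup>\<close> bounds its norm by \<open>p / \<mu>\<close> times that of \<open>\<partial>f / \<partial>t\<close>. The second summand is
  bounded by the Poincare inequality of the torus, applied to \<open>f(r, \<cdot>)\<close>, with \<open>c\<close> depending on \<open>r\<close>; for
  this the tangential gradient on the single slice \<open>r\<close> has to be bounded by the gradient on the ball.
  On a fixed slice such as \<open>r = R\<close> this is impossible, but it holds for some slice in any collar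
  of the boundary, by averaging. The slice therefore has to be movable without spoiling the constant
  \<open>p / \<mu>\<close>. This is so: Hardy's inequality keeps that constant as long as \<open>R - r \<le> 1 / (2 \<mu>)\<close>
  (\<open>hardy_exponential_weight\<close>). The mass of the whole ball is at most
  \<open>A = 1 / (1 - e\<^bsup>-1/2\<^esup>)\<close> times the mass of the collar of this width, and the Euclidean gradient along a slice
  is at most \<open>e\<^bsup>\<mu>\<^sub>n R\<^esup>\<close> times the Riemannian gradient, which
  gives the factor \<open>A\<^bsup>1/p\<^esup> e\<^bsup>\<mu>\<^sub>n R\<^esup>\<close> in the second term. The constant \<open>A\<close> is even absolute.

  All estimates compare integrals of \<open>p\<close>-th powers, in \<open>poincare_slab\<close>, and are combined by a pointwise
  form of Minkowski's inequality, \<open>powr_add_le_weighted\<close>.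
\<close>

section \<open>Convexity of powers\<close>

text \<open>
  Young's inequality for \<open>v\<^bsup>p-1\<^esup> y\<close>, balanced by a free parameter \<open>k\<close>: in terms of \<open>z = y / (k v)\<close> it is
  Bernoulli's inequality \<open>p z \<le> p - 1 + z\<^sup>p\<close>.
\<close>

lemma young_powr:
  fixes p k v y :: real
  assumes "1 \<le> p" "0 < k" "0 < v" "0 \<le> y"
  shows "p * v powr (p - 1) * y \<le> (p - 1) * k * v powr p + k powr (1 - p) * y powr p"
proof -
  define z where "z = y / (k * v)"
  have z: "0 \<le> z" "y = k * v * z" using assms by (auto simp: z_def)
  have yp: "y powr p = k powr p * v powr p * z powr p"
    using assms z by (simp add: powr_mult)
  have vp: "v powr (p - 1) * v = v powr p" using assms by (simp add: powr_diff)
  have kp: "k powr (1 - p) * k powr p = k" using assms by (simp flip: powr_add)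
  have bern: "p * z \<le> p - 1 + z powr p"
  proof -
    have "z powr p \<noteq> 0 \<Longrightarrow> (z powr p) powr (1/p) * 1 powr (1 - 1/p) \<le> 1/p * z powr p + (1 - 1/p) * 1"
      using assms z by (intro Youngs_inequality_0) auto
    then have "z \<le> 1/p * z powr p + (1 - 1/p)"
      using assms z by (cases "z = 0") (auto simp: powr_powr)
    then have "p * z \<le> p * (1/p * z powr p + (1 - 1/p))"
      using assms by (intro mult_left_mono) auto
    then show ?thesis using assms by (simp add: algebra_simps)
  qed
  have "p * v powr (p - 1) * y = k * v powr p * (p * z)"
    by (simp add: z vp[symmetric] mult_ac)
  also have "\<dots> \<le> k * v powr p * (p - 1 + z powr p)"
    using bern assms by (intro mult_left_mono) auto
  also have "\<dots> = (p - 1) * k * v powr p + (k powr (1 - p) * k powr p) * (v powr p * z powr p)"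
    unfolding kp by (simp add: algebra_simps)
  also have "\<dots> = (p - 1) * k * v powr p + k powr (1 - p) * y powr p"
    by (simp add: yp mult_ac)
  finally show ?thesis .
qed

text \<open>
  Minkowski's inequality in pointwise form. Once \<open>\<integral> x\<^sup>p \<le> \<alpha>\<^sup>p K\<close> and \<open>\<integral> y\<^sup>p \<le> \<beta>\<^sup>p K\<close> are known, integrating it
  gives \<open>\<integral> (x + y)\<^sup>p \<le> (\<alpha> + \<beta>)\<^sup>p K\<close> with no loss. It is convexity of \<open>s \<mapsto> s\<^sup>p\<close> at the points \<open>x / \<alpha>\<close> and
  \<open>y / \<beta>\<close> with weights proportional to \<open>\<alpha>\<close> and \<open>\<beta>\<close>, deduced from the tangent inequality at
  their mean \<open>(x + y) / (\<alpha> + \<beta>)\<close>.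
\<close>

lemma powr_add_le_weighted:
  fixes p \<alpha> \<beta> x y :: real
  assumes p: "1 \<le> p" and "0 < \<alpha>" "0 < \<beta>" "0 \<le> x" "0 \<le> y"
  shows "(x + y) powr p \<le> (\<alpha> + \<beta>) powr (p - 1) * (\<alpha> powr (1 - p) * x powr p + \<beta> powr (1 - p) * y powr p)"
proof -
  define s where "s = x + y"
  consider "s = 0" | "0 < s" using assms by (fastforce simp: s_def)
  then show ?thesis
  proof cases
    case 1 then show ?thesis using assms by (simp add: s_def)
  next
    case 2
    \<comment> \<open>The tangent to \<open>s\<^sup>p\<close> at \<open>(x + y) / (\<alpha> + \<beta>)\<close> lies below the graph: Young's inequality with \<open>k = 1\<close>.\<close>
    have T: "p * (s / (\<alpha> + \<beta>)) powr (p - 1) * (z / c) - (p - 1) * (s / (\<alpha> + \<beta>)) powr p \<le> (z / c) powr p"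
      if "0 \<le> z" "0 < c" for z c
      using young_powr[of p 1 "s / (\<alpha> + \<beta>)" "z / c"] that assms 2 by simp
    let ?r = "s / (\<alpha> + \<beta>)"
    have r: "?r powr (p - 1) * s = (\<alpha> + \<beta>) * ?r powr p"
      using 2 assms by (simp add: powr_diff)
    have *: "c * (z / c) powr p = c powr (1 - p) * z powr p" if "0 \<le> z" "0 < c" for z c
      using that by (simp add: powr_divide powr_diff)
    have "\<alpha> * (x / \<alpha>) powr p + \<beta> * (y / \<beta>) powr p \<ge>
      \<alpha> * (p * ?r powr (p - 1) * (x / \<alpha>) - (p - 1) * ?r powr p) + \<beta> * (p * ?r powr (p - 1) * (y / \<beta>) - (p - 1) * ?r powr p)"
      using assms T by (intro add_mono mult_left_mono) auto
    also have "\<alpha> * (p * ?r powr (p - 1) * (x / \<alpha>) - (p - 1) * ?r powr p) + \<beta> * (p * ?r powr (p - 1) * (y / \<beta>) - (p - 1) * ?r powr p)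
       = p * (?r powr (p - 1) * s) - (\<alpha> + \<beta>) * (p - 1) * ?r powr p"
      using assms by (simp add: s_def algebra_simps)
    also have "\<dots> = (\<alpha> + \<beta>) * ?r powr p"
      unfolding r by (simp add: algebra_simps)
    also have "\<dots> = (\<alpha> + \<beta>) powr (1 - p) * s powr p"
      using assms 2 by (intro *) auto
    finally have le: "(\<alpha> + \<beta>) powr (1 - p) * s powr p \<le> \<alpha> powr (1 - p) * x powr p + \<beta> powr (1 - p) * y powr p"
      using assms by (simp add: *)
    have "s powr p = (\<alpha> + \<beta>) powr (p - 1) * ((\<alpha> + \<beta>) powr (1 - p) * s powr p)"
      using assms by (simp flip: powr_add mult.assoc)
    also have "\<dots> \<le> (\<alpha> + \<beta>) powr (p - 1) * (\<alpha> powr (1 - p) * x powr p + \<beta> powr (1 - p) * y powr p)"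
      using le by (intro mult_left_mono) auto
    finally show ?thesis by (simp add: s_def)
  qed
qed

section \<open>A Hardy inequality with exponential weight\<close>

text \<open>
  Hardy inequalities by integrating a divergence: \<open>(\<phi> v\<^sup>p)' = \<phi>' v\<^sup>p + p \<phi> v\<^bsup>p-1\<^esup> v'\<close>, and Young's inequality
  splits the mixed term into a part absorbed by \<open>\<phi>'\<close> and a multiple of \<open>\<bar>v'\<bar>\<^sup>p\<close>. Each weight \<open>w\<close> then
  only requires a field \<open>\<phi>\<close> satisfying two pointwise inequalities.
\<close>

lemma integral_powr_weighted_le_vector_field:
  fixes v v' \<phi> \<phi>' w :: "real \<Rightarrow> real"
  assumes p: "1 \<le> p" and k: "0 < k" and ab: "a \<le> b"
    and v: "\<And>t. t \<in> {a..b} \<Longrightarrow> (v has_real_derivative v' t) (at t within {a..b})"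
    and v0: "\<And>t. t \<in> {a..b} \<Longrightarrow> 0 < v t"
    and \<phi>: "\<And>t. t \<in> {a..b} \<Longrightarrow> (\<phi> has_real_derivative \<phi>' t) (at t within {a..b})"
    and w: "\<And>t. t \<in> {a..b} \<Longrightarrow> \<bar>\<phi> t\<bar> \<le> w t / k"
    and div: "\<And>t. t \<in> {a..b} \<Longrightarrow> \<phi>' t + (p - 1) * k * \<bar>\<phi> t\<bar> \<le> - w t"
    and I: "(\<lambda>t. w t * v t powr p) integrable_on {a..b}"
      "(\<lambda>t. w t * \<bar>v' t\<bar> powr p) integrable_on {a..b}"
  shows "integral {a..b} (\<lambda>t. w t * v t powr p)
    \<le> k powr - p * integral {a..b} (\<lambda>t. w t * \<bar>v' t\<bar> powr p) + \<phi> a * v a powr p - \<phi> b * v b powr p"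
proof -
  define D where "D t = \<phi>' t * v t powr p + \<phi> t * (p * v t powr (p - 1) * v' t)" for t
  have "((\<lambda>t. \<phi> t * v t powr p) has_real_derivative D t) (at t within {a..b})" if "t \<in> {a..b}" for t
    unfolding D_def using v0[OF that]
    by (auto intro!: derivative_eq_intros v[OF that] \<phi>[OF that] simp: powr_diff field_simps)
  then have ftc: "(D has_integral (\<phi> b * v b powr p - \<phi> a * v a powr p)) {a..b}"
    using ab by (intro fundamental_theorem_of_calculus) (auto simp: has_real_derivative_iff_has_vector_derivative)
  have le: "D t \<le> k powr - p * (w t * \<bar>v' t\<bar> powr p) - w t * v t powr p" if t: "t \<in> {a..b}" for t
  proof -
    have "D t \<le> \<phi>' t * v t powr p + \<bar>\<phi> t\<bar> * (p * v t powr (p - 1) * \<bar>v' t\<bar>)"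
    proof -
      have "\<phi> t * (p * v t powr (p - 1) * v' t) \<le> \<bar>\<phi> t * (p * v t powr (p - 1) * v' t)\<bar>" by simp
      also have "\<dots> = \<bar>\<phi> t\<bar> * (p * v t powr (p - 1) * \<bar>v' t\<bar>)" using p by (simp add: abs_mult)
      finally show ?thesis by (simp add: D_def)
    qed
    also have "\<dots> \<le> \<phi>' t * v t powr p + \<bar>\<phi> t\<bar> * ((p - 1) * k * v t powr p + k powr (1 - p) * \<bar>v' t\<bar> powr p)"
      using v0[OF t] p k by (intro add_left_mono mult_left_mono young_powr) auto
    also have "\<dots> = (\<phi>' t + (p - 1) * k * \<bar>\<phi> t\<bar>) * v t powr p + \<bar>\<phi> t\<bar> * (k powr (1 - p) * \<bar>v' t\<bar> powr p)"
      by (simp add: algebra_simps)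
    also have "\<dots> \<le> - w t * v t powr p + (w t / k) * (k powr (1 - p) * \<bar>v' t\<bar> powr p)"
      using div[OF t] w[OF t] k by (intro add_mono mult_right_mono) auto
    also have "\<dots> = k powr - p * (w t * \<bar>v' t\<bar> powr p) - w t * v t powr p"
      using k by (simp add: powr_diff powr_minus field_simps)
    finally show ?thesis .
  qed
  have "\<phi> b * v b powr p - \<phi> a * v a powr p
    \<le> k powr - p * integral {a..b} (\<lambda>t. w t * \<bar>v' t\<bar> powr p) - integral {a..b} (\<lambda>t. w t * v t powr p)"
    by (rule has_integral_le[OF ftc _ le])
      (intro has_integral_diff has_integral_mult_right integrable_integral I)
  then show ?thesis by simp
qed

text \<open>
  Since \<open>\<bar>u\<bar>\<^sup>p\<close> need not be differentiable where \<open>u\<close> vanishes (for \<open>p = 1\<close>), the positive functions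
  \<open>v\<^sub>e = \<surd>(u\<^sup>2 + e\<^sup>2)\<close> stand in for \<open>\<bar>u\<bar>\<close>: they satisfy \<open>\<bar>u\<bar> \<le> v\<^sub>e\<close> and \<open>\<bar>v\<^sub>e'\<bar> \<le> \<bar>u'\<bar>\<close>, so that only the boundary
  terms depend on \<open>e\<close>, and these converge as \<open>e \<rightarrow> 0\<close>.
\<close>

lemma integral_abs_powr_weighted_le_vector_field:
  fixes u u' \<phi> \<phi>' w :: "real \<Rightarrow> real"
  assumes p: "1 \<le> p" and k: "0 < k" and ab: "a \<le> b"
    and u: "\<And>t. t \<in> {a..b} \<Longrightarrow> (u has_real_derivative u' t) (at t within {a..b})"
    and u': "continuous_on {a..b} u'" and wc: "continuous_on {a..b} w"
    and \<phi>: "\<And>t. t \<in> {a..b} \<Longrightarrow> (\<phi> has_real_derivative \<phi>' t) (at t within {a..b})"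
    and w: "\<And>t. t \<in> {a..b} \<Longrightarrow> \<bar>\<phi> t\<bar> \<le> w t / k"
    and div: "\<And>t. t \<in> {a..b} \<Longrightarrow> \<phi>' t + (p - 1) * k * \<bar>\<phi> t\<bar> \<le> - w t"
  shows "integral {a..b} (\<lambda>t. w t * \<bar>u t\<bar> powr p)
    \<le> k powr - p * integral {a..b} (\<lambda>t. w t * \<bar>u' t\<bar> powr p)
      + \<phi> a * \<bar>u a\<bar> powr p - \<phi> b * \<bar>u b\<bar> powr p"
    (is "?L \<le> ?M + _ - _")
proof -
  define v where "v e t = sqrt ((u t)\<^sup>2 + e\<^sup>2)" for e t
  have uc: "continuous_on {a..b} u"
    using u by (meson DERIV_continuous_on)
  have w0: "0 \<le> w t" if "t \<in> {a..b}" for t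
    using w[OF that] k by (smt (verit) divide_neg_pos)
  have bound: "?L \<le> ?M + \<phi> a * v e a powr p - \<phi> b * v e b powr p" if e: "0 < e" for e
  proof -
    define v' where "v' t = u t * u' t / v e t" for t
    have pos: "0 < (u t)\<^sup>2 + e\<^sup>2" for t
      using e by (simp add: add_nonneg_pos)
    have vpos: "0 < v e t" for t
      using pos by (simp add: v_def)
    have v: "(v e has_real_derivative v' t) (at t within {a..b})" if "t \<in> {a..b}" for t
      using pos[of t] unfolding v_def v'_def
      by (auto intro!: derivative_eq_intros u[OF that] simp: field_simps)
    have vc: "continuous_on {a..b} (v e)"
      unfolding v_def by (intro continuous_intros uc)
    have v'c: "continuous_on {a..b} v'"
      unfolding v'_def using vpos by (intro continuous_intros uc u' vc) (metis less_irrefl)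
    have uv: "\<bar>u t\<bar> \<le> v e t" for t
      unfolding v_def by (rule real_le_rsqrt) simp
    have v'u: "\<bar>v' t\<bar> \<le> \<bar>u' t\<bar>" for t
    proof -
      have "\<bar>v' t\<bar> = (\<bar>u t\<bar> / v e t) * \<bar>u' t\<bar>"
        using vpos[of t] by (simp add: v'_def abs_mult)
      also have "\<dots> \<le> 1 * \<bar>u' t\<bar>"
        using uv[of t] vpos[of t] by (intro mult_right_mono) auto
      finally show ?thesis by simp
    qed
    have "?L \<le> integral {a..b} (\<lambda>t. w t * v e t powr p)"
      using p uv w0
      by (intro integral_le integrable_continuous_real continuous_intros wc uc vc continuous_on_powr' mult_left_mono powr_mono2)
        (use vpos in \<open>auto simp: less_imp_le\<close>)
    also have "\<dots> \<le> k powr - p * integral {a..b} (\<lambda>t. w t * \<bar>v' t\<bar> powr p)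
        + \<phi> a * v e a powr p - \<phi> b * v e b powr p"
      using p
      by (intro integral_powr_weighted_le_vector_field[OF p k ab v vpos \<phi> w div]
          integrable_continuous_real continuous_intros wc vc v'c continuous_on_powr')
        (use vpos in \<open>auto simp: less_imp_le\<close>)
    also have "integral {a..b} (\<lambda>t. w t * \<bar>v' t\<bar> powr p) \<le> integral {a..b} (\<lambda>t. w t * \<bar>u' t\<bar> powr p)"
      using p v'u w0
      by (intro integral_le integrable_continuous_real continuous_intros wc u' v'c continuous_on_powr' mult_left_mono powr_mono2)
        auto
    finally show ?thesis by (simp add: mult_left_mono)
  qed
  have lim: "((\<lambda>e. v e t powr p) \<longlongrightarrow> \<bar>u t\<bar> powr p) (at_right 0)" for t
  proof -
    have "((\<lambda>e. v e t) \<longlongrightarrow> sqrt ((u t)\<^sup>2 + 0\<^sup>2)) (at_right 0)"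
      unfolding v_def by (intro tendsto_intros)
    then have "((\<lambda>e. v e t powr p) \<longlongrightarrow> sqrt ((u t)\<^sup>2 + 0\<^sup>2) powr p) (at_right 0)"
      using p by (intro tendsto_powr' tendsto_const) (auto simp: v_def intro!: always_eventually)
    then show ?thesis by simp
  qed
  show ?thesis
  proof (rule tendsto_lowerbound)
    show "((\<lambda>e. ?M + \<phi> a * v e a powr p - \<phi> b * v e b powr p)
        \<longlongrightarrow> ?M + \<phi> a * \<bar>u a\<bar> powr p - \<phi> b * \<bar>u b\<bar> powr p) (at_right 0)"
      by (intro tendsto_intros lim)
    show "\<forall>\<^sub>F e in at_right 0. ?L \<le> ?M + \<phi> a * v e a powr p - \<phi> b * v e b powr p"
      using bound by (auto simp: eventually_at_right_less intro: eventually_mono[OF eventually_at_right_less])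
  qed simp
qed

text \<open>
  On the left of the zero \<open>r\<close>, where the weight \<open>w = e\<^bsup>m t\<^esup>\<close> increases towards the zero, the field
  \<open>- w p / m\<close> gives the sharp constant \<open>p / m\<close> on an interval of any length. On the right of \<open>r\<close> the
  weight increases away from the zero, and no constant works uniformly in the length; but on an interval of
  length at most \<open>1 / (2 m)\<close> the field \<open>2 p (b - t) w\<close>, which vanishes at the free end \<open>b\<close>,
  gives the same constant. Hence the zero may lie anywhere within \<open>1 / (2 m)\<close> of the right end
  at no cost.
\<close>

lemma hardy_exponential_weight:
  fixes u u' :: "real \<Rightarrow> real"
  assumes p: "1 \<le> p" and m: "0 < m" and r: "a \<le> r" "r \<le> b" "b \<le> r + 1 / (2 * m)"
    and u: "\<And>t. t \<in> {a..b} \<Longrightarrow> (u has_real_derivative u' t) (at t within {a..b})"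
    and u': "continuous_on {a..b} u'" and zero: "u r = 0"
  shows "integral {a..b} (\<lambda>t. exp (m * t) * \<bar>u t\<bar> powr p)
    \<le> (p / m) powr p * integral {a..b} (\<lambda>t. exp (m * t) * \<bar>u' t\<bar> powr p)"
proof -
  let ?k = "m / p" and ?w = "\<lambda>t. exp (m * t)"
  have k: "0 < ?k" using p m by simp
  have kp: "?k powr - p = (p / m) powr p"
    using p m by (simp add: powr_minus powr_divide field_simps)
  have sub: "continuous_on {c..d} u'"
    "t \<in> {c..d} \<Longrightarrow> (u has_real_derivative u' t) (at t within {c..d})" if "a \<le> c" "d \<le> b" for c d t
  proof -
    have s: "{c..d} \<subseteq> {a..b}" using that by auto
    show "continuous_on {c..d} u'" using u' s by (rule continuous_on_subset)
    show "(u has_real_derivative u' t) (at t within {c..d})" if "t \<in> {c..d}"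
      using u s that by (meson DERIV_subset subsetD)
  qed
  have uc: "continuous_on {a..b} u"
    using u by (meson DERIV_continuous_on)
  have left: "integral {a..r} (\<lambda>t. ?w t * \<bar>u t\<bar> powr p)
    \<le> (p / m) powr p * integral {a..r} (\<lambda>t. ?w t * \<bar>u' t\<bar> powr p)"
  proof -
    have "integral {a..r} (\<lambda>t. ?w t * \<bar>u t\<bar> powr p)
      \<le> ?k powr - p * integral {a..r} (\<lambda>t. ?w t * \<bar>u' t\<bar> powr p)
        + - (?w a / ?k) * \<bar>u a\<bar> powr p - - (?w r / ?k) * \<bar>u r\<bar> powr p"
    proof (rule integral_abs_powr_weighted_le_vector_field[OF p k r(1), where \<phi>' = "\<lambda>t. - (p * ?w t)"])
      show "((\<lambda>t. - (?w t / ?k)) has_real_derivative - (p * ?w t)) (at t within {a..r})" for t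
        using m by (auto intro!: derivative_eq_intros)
      show "- (p * ?w t) + (p - 1) * ?k * \<bar>- (?w t / ?k)\<bar> \<le> - ?w t" for t
        using p m by (simp add: field_simps)
    qed (use r p m in \<open>auto intro!: sub continuous_intros\<close>)
    also have "\<dots> \<le> (p / m) powr p * integral {a..r} (\<lambda>t. ?w t * \<bar>u' t\<bar> powr p)"
      using zero p m unfolding kp by simp
    finally show ?thesis .
  qed
  have right: "integral {r..b} (\<lambda>t. ?w t * \<bar>u t\<bar> powr p)
    \<le> (p / m) powr p * integral {r..b} (\<lambda>t. ?w t * \<bar>u' t\<bar> powr p)"
  proof -
    let ?\<phi> = "\<lambda>t. 2 * p * (b - t) * ?w t"
    have "integral {r..b} (\<lambda>t. ?w t * \<bar>u t\<bar> powr p)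
      \<le> ?k powr - p * integral {r..b} (\<lambda>t. ?w t * \<bar>u' t\<bar> powr p)
        + ?\<phi> r * \<bar>u r\<bar> powr p - ?\<phi> b * \<bar>u b\<bar> powr p"
    proof (rule integral_abs_powr_weighted_le_vector_field[OF p k r(2),
          where \<phi>' = "\<lambda>t. 2 * p * (m * (b - t) - 1) * ?w t"])
      fix t assume t: "t \<in> {r..b}"
      have "b - t \<le> 1 / (2 * m)" using t r by simp
      \<comment> \<open>The length bound on the interval is what the divergence condition below needs.\<close>
      then have s: "0 \<le> m * (b - t)" "m * (b - t) \<le> 1 / 2" using m t by (auto simp: field_simps)
      show "(?\<phi> has_real_derivative 2 * p * (m * (b - t) - 1) * ?w t) (at t within {r..b})"
        by (auto intro!: derivative_eq_intros simp: algebra_simps)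
      have abs: "\<bar>?\<phi> t\<bar> = ?\<phi> t" using t p by simp
      have "2 * p * (b - t) \<le> 1 / ?k"
        using mult_left_mono[OF s(2), of "2 * p / m"] p m by simp
      then show "\<bar>?\<phi> t\<bar> \<le> ?w t / ?k"
        unfolding abs using mult_right_mono[of "2 * p * (b - t)" "1 / ?k" "?w t"] by (simp add: mult.commute)
      have "2 * p * (m * (b - t) - 1) + (p - 1) * ?k * (2 * p * (b - t))
          = (4 * p - 2) * (m * (b - t)) - 2 * p"
        using p by (simp add: field_simps)
      also have "\<dots> \<le> (4 * p - 2) * (1 / 2) - 2 * p"
        using s p by (intro diff_right_mono mult_left_mono) auto
      also have "\<dots> = - 1" by (simp add: field_simps)
      finally have "2 * p * (m * (b - t) - 1) + (p - 1) * ?k * (2 * p * (b - t)) \<le> - 1" .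
      from mult_right_mono[OF this, of "?w t"]
      show "2 * p * (m * (b - t) - 1) * ?w t + (p - 1) * ?k * \<bar>?\<phi> t\<bar> \<le> - ?w t"
        unfolding abs by (simp add: algebra_simps)
    qed (use r in \<open>auto intro!: sub continuous_intros\<close>)
    then show ?thesis using zero p unfolding kp by simp
  qed
  have int: "(\<lambda>t. ?w t * \<bar>u t\<bar> powr p) integrable_on {a..b}" "(\<lambda>t. ?w t * \<bar>u' t\<bar> powr p) integrable_on {a..b}"
    using p by (intro integrable_continuous_real continuous_intros uc u' continuous_on_powr'; simp)+
  show ?thesis
    using add_mono[OF left right] Henstock_Kurzweil_Integration.integral_combine[OF r(1,2) int(1)] Henstock_Kurzweil_Integration.integral_combine[OF r(1,2) int(2)]
    by (simp flip: distrib_left)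
qed

lemma hardy_exponential_weight_nn_integral:
  fixes u u' :: "real \<Rightarrow> real"
  assumes p: "1 \<le> p" and m: "0 < m" and r: "a \<le> r" "r \<le> b" "b \<le> r + 1 / (2 * m)"
    and u: "\<And>t. t \<in> {a..b} \<Longrightarrow> (u has_real_derivative u' t) (at t within {a..b})"
    and u': "continuous_on {a..b} u'" and zero: "u r = 0"
  shows "(\<integral>\<^sup>+t\<in>{a..b}. ennreal (\<bar>u t\<bar> powr p * exp (m * t)) \<partial>lborel)
    \<le> ennreal ((p / m) powr p) * (\<integral>\<^sup>+t\<in>{a..b}. ennreal (\<bar>u' t\<bar> powr p * exp (m * t)) \<partial>lborel)"
proof -
  have nn: "(\<integral>\<^sup>+t\<in>{a..b}. ennreal (\<bar>g t\<bar> powr p * exp (m * t)) \<partial>lborel)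
      = ennreal (integral {a..b} (\<lambda>t. exp (m * t) * \<bar>g t\<bar> powr p))" if "continuous_on {a..b} g" for g
  proof -
    have "(\<lambda>t. \<bar>g t\<bar> powr p * exp (m * t)) integrable_on {a..b}"
      using p that by (intro integrable_continuous_real continuous_intros continuous_on_powr'; simp)
    then show ?thesis
      by (subst nn_integral_has_integral_lebesgue'[OF _ integrable_integral]) (auto simp: mult.commute)
  qed
  have uc: "continuous_on {a..b} u"
    using u by (meson DERIV_continuous_on)
  show ?thesis
    unfolding nn[OF uc] nn[OF u'] using hardy_exponential_weight[OF assms]
    by (simp flip: ennreal_mult' add: ennreal_leI)
qed

section \<open>Integration over products and weighted averages\<close>

lemma nn_integral_Times_lborel:
  fixes \<phi> :: "'a::euclidean_space \<times> 'b::euclidean_space \<Rightarrow> ennreal"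
  assumes "(\<lambda>z. \<phi> z * indicator (A \<times> F) z) \<in> borel_measurable borel"
  shows "(\<integral>\<^sup>+z\<in>A \<times> F. \<phi> z \<partial>lborel) = (\<integral>\<^sup>+t\<in>A. (\<integral>\<^sup>+x\<in>F. \<phi> (t, x) \<partial>lborel) \<partial>lborel)"
    and "(\<integral>\<^sup>+z\<in>A \<times> F. \<phi> z \<partial>lborel) = (\<integral>\<^sup>+x\<in>F. (\<integral>\<^sup>+t\<in>A. \<phi> (t, x) \<partial>lborel) \<partial>lborel)"
    and "(\<lambda>t. (\<integral>\<^sup>+x\<in>F. \<phi> (t, x) \<partial>lborel) * indicator A t) \<in> borel_measurable borel"
    and "(\<lambda>x. (\<integral>\<^sup>+t\<in>A. \<phi> (t, x) \<partial>lborel) * indicator F x) \<in> borel_measurable borel"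
proof -
  have m: "(\<lambda>z. \<phi> z * indicator (A \<times> F) z) \<in> borel_measurable (lborel \<Otimes>\<^sub>M lborel)"
    using assms by (simp add: lborel_prod)
  have 1: "(\<integral>\<^sup>+x. \<phi> (t, x) * indicator (A \<times> F) (t, x) \<partial>lborel) = (\<integral>\<^sup>+x\<in>F. \<phi> (t, x) \<partial>lborel) * indicator A t" for t
    by (cases "t \<in> A") (auto simp: indicator_def intro!: nn_integral_cong)
  have 2: "(\<integral>\<^sup>+t. \<phi> (t, x) * indicator (A \<times> F) (t, x) \<partial>lborel) = (\<integral>\<^sup>+t\<in>A. \<phi> (t, x) \<partial>lborel) * indicator F x" for x
    by (cases "x \<in> F") (auto simp: indicator_def intro!: nn_integral_cong)
  show "(\<integral>\<^sup>+z\<in>A \<times> F. \<phi> z \<partial>lborel) = (\<integral>\<^sup>+t\<in>A. (\<integral>\<^sup>+x\<in>F. \<phi> (t, x) \<partial>lborel) \<partial>lborel)"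
    using lborel.nn_integral_fst[OF m] by (simp add: 1 lborel_prod)
  show "(\<integral>\<^sup>+z\<in>A \<times> F. \<phi> z \<partial>lborel) = (\<integral>\<^sup>+x\<in>F. (\<integral>\<^sup>+t\<in>A. \<phi> (t, x) \<partial>lborel) \<partial>lborel)"
    using lborel_pair.nn_integral_snd[OF m] by (simp add: 2 lborel_prod)
  show "(\<lambda>t. (\<integral>\<^sup>+x\<in>F. \<phi> (t, x) \<partial>lborel) * indicator A t) \<in> borel_measurable borel"
    using lborel.borel_measurable_nn_integral_fst[OF m] by (simp add: 1)
  have "(\<lambda>(x, t). \<phi> (t, x) * indicator (A \<times> F) (t, x)) \<in> borel_measurable (lborel \<Otimes>\<^sub>M lborel)"
    using measurable_pair_swap[OF m] by (simp add: split_beta')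
  from lborel.borel_measurable_nn_integral_fst[OF this]
  show "(\<lambda>x. (\<integral>\<^sup>+t\<in>A. \<phi> (t, x) \<partial>lborel) * indicator F x) \<in> borel_measurable borel"
    by (simp add: 2)
qed

lemma nn_integral_exp_Icc:
  fixes m :: real
  assumes "0 < m" "a \<le> b"
  shows "(\<integral>\<^sup>+t\<in>{a..b}. ennreal (exp (m * t)) \<partial>lborel) = ennreal ((exp (m * b) - exp (m * a)) / m)"
proof -
  have "(\<integral>\<^sup>+t\<in>{a..b}. ennreal (exp (m * t)) \<partial>lborel) = ennreal (exp (m * b) / m - exp (m * a) / m)"
    using assms by (intro nn_integral_FTC_Icc) (auto intro!: derivative_eq_intros)
  then show ?thesis by (simp add: diff_divide_distrib)
qed

text \<open>
  Cross-multiplied by the total mass, so that it makes sense for extended nonnegative functions.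
  If it failed everywhere on \<open>A\<close>, integrating the strict inequality would contradict itself.
\<close>

lemma exists_le_weighted_average:
  fixes H :: "'a \<Rightarrow> ennreal" and w :: "'a \<Rightarrow> real"
  assumes A[measurable]: "A \<in> sets M" and H: "(\<lambda>t. H t * indicator A t) \<in> borel_measurable M"
    and w[measurable]: "w \<in> borel_measurable M" and pos: "\<And>t. t \<in> A \<Longrightarrow> 0 < w t"
    and W: "(\<integral>\<^sup>+t\<in>A. ennreal (w t) \<partial>M) \<noteq> 0" "(\<integral>\<^sup>+t\<in>A. ennreal (w t) \<partial>M) \<noteq> \<infinity>"
    and fin: "(\<integral>\<^sup>+t\<in>A. H t * ennreal (w t) \<partial>M) \<noteq> \<infinity>"
  obtains r where "r \<in> A" "(\<integral>\<^sup>+t\<in>A. ennreal (w t) \<partial>M) * H r \<le> (\<integral>\<^sup>+t\<in>A. H t * ennreal (w t) \<partial>M)"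
proof (rule ccontr)
  define G where "G = (\<lambda>t. H t * indicator A t)"
  have [measurable]: "G \<in> borel_measurable M"
    using H unfolding G_def .
  let ?W = "\<integral>\<^sup>+t\<in>A. ennreal (w t) \<partial>M" and ?K = "\<integral>\<^sup>+t\<in>A. H t * ennreal (w t) \<partial>M"
  let ?f = "\<lambda>t. ?K * (ennreal (w t) * indicator A t)" and ?g = "\<lambda>t. ?W * (ennreal (w t) * G t)"
  assume "\<not> thesis"
  with that have less: "?K < ?W * H t" if "t \<in> A" for t
    using that by (meson not_le)
  have f: "integral\<^sup>N M ?f = ?K * ?W"
    by (rule nn_integral_cmult) measurable
  have "integral\<^sup>N M ?g = ?W * (\<integral>\<^sup>+t. ennreal (w t) * G t \<partial>M)"
    by (rule nn_integral_cmult) measurable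
  then have g: "integral\<^sup>N M ?g = ?K * ?W"
    by (simp add: G_def mult_ac)
  have "integral\<^sup>N M ?f < integral\<^sup>N M ?g"
  proof (rule nn_integral_less)
    show "integral\<^sup>N M ?f \<noteq> \<infinity>"
      unfolding f using W fin by (simp add: ennreal_mult_eq_top_iff)
    have gf: "?f t \<le> ?g t" for t
      using less[of t] mult_right_mono[of ?K "?W * H t" "ennreal (w t)"]
      by (cases "t \<in> A") (auto simp: G_def mult_ac)
    then show "AE t in M. ?f t \<le> ?g t" by simp
    show "\<not> (AE t in M. ?g t \<le> ?f t)"
    proof
      assume "AE t in M. ?g t \<le> ?f t"
      then have "AE t in M. ennreal (w t) * indicator A t = 0"
      proof eventually_elim
        case (elim t)
        show ?case
        proof (rule ccontr)
          assume nz: "ennreal (w t) * indicator A t \<noteq> 0"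
          then have t: "t \<in> A" by (auto simp: indicator_def split: if_splits)
          with elim have le: "ennreal (w t) * (?W * H t) \<le> ennreal (w t) * ?K"
            by (simp add: G_def mult_ac)
          from le pos[OF t] have "?W * H t \<le> ?K"
            by (simp add: ennreal_mult_le_mult_iff)
          with less[OF t] show False by simp
        qed
      qed
      then have "?W = 0"
        by (subst nn_integral_0_iff_AE) auto
      with W show False by simp
    qed
  qed measurable
  then show False unfolding f g by simp
qed

section \<open>The Poincare inequality on a slab\<close>

lemma measurable_slab:
  fixes k :: "real \<times> 'a::euclidean_space \<Rightarrow> real"
  assumes k: "continuous_on ({a..b} \<times> UNIV) k" and F: "F \<in> sets borel"
  shows "(\<lambda>z. ennreal (k z) * indicator ({a..b} \<times> F) z) \<in> borel_measurable borel"
proof -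
  have "closed ({a..b} \<times> (UNIV :: 'a set))" by (intro closed_Times) auto
  then have "{a..b} \<times> (UNIV :: 'a set) \<in> sets borel" by simp
  then have k': "(\<lambda>z. indicator ({a..b} \<times> UNIV) z *\<^sub>R k z) \<in> borel_measurable borel"
    using k by (rule borel_measurable_continuous_on_indicator)
  have "snd \<in> borel_measurable (borel :: (real \<times> 'a) measure)"
    using continuous_on_snd[OF continuous_on_id] by (intro borel_measurable_continuous_onI) simp
  from measurable_sets[OF this F] have "snd -` F \<in> sets (borel :: (real \<times> 'a) measure)" by simp
  then have "(\<lambda>z. ennreal (indicator ({a..b} \<times> UNIV) z *\<^sub>R k z) * indicator (snd -` F) z) \<in> borel_measurable borel"
    using k' by measurable
  also have "(\<lambda>z. ennreal (indicator ({a..b} \<times> UNIV) z *\<^sub>R k z) * indicator (snd -` F) z)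
      = (\<lambda>z. ennreal (k z) * indicator ({a..b} \<times> F) z)"
    by (auto simp: fun_eq_iff indicator_def)
  finally show ?thesis .
qed

text \<open>
  The analytic core, with the geometry reduced to four functions: \<open>q\<close> is the derivative of \<open>f\<close> along
  the interval, \<open>h\<close> the length of the Euclidean gradient along the slices \<open>{t} \<times> F\<close>, and \<open>g\<close> that of
  the full gradient. A slice \<open>r\<close> is chosen on which \<open>h\<close> is at most its average over the slices within
  \<open>1 / (2 m)\<close> of the end \<open>R\<close>. The function \<open>f - f(r, \<cdot>)\<close> vanishes on that slice and is controlled by the
  Hardy inequality on each line, while \<open>f(r, \<cdot>) - c\<close> is controlled by the inequality assumed
  on slices. The mass \<open>e\<^bsup>m t\<^esup> dt\<close> of \<open>[0, R]\<close> exceeds that of the collar over which the average is taken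
  by a factor of at most \<open>A = 1 / (1 - e\<^bsup>-1/2\<^esup>)\<close>, independently of \<open>m\<close>, \<open>p\<close> and \<open>R\<close>.
\<close>

lemma poincare_slab:
  fixes f q g h :: "real \<times> 'a::euclidean_space \<Rightarrow> real"
  assumes p: "1 \<le> p" and m: "0 < m" and R: "0 < R" and E: "0 < E" and C: "0 < C"
    and F: "F \<in> sets borel"
    and f: "continuous_on ({0..R} \<times> UNIV) f" and q: "continuous_on ({0..R} \<times> UNIV) q"
    and g: "continuous_on ({0..R} \<times> UNIV) g" and h: "continuous_on ({0..R} \<times> UNIV) h"
    and deriv: "\<And>t x. t \<in> {0..R} \<Longrightarrow> ((\<lambda>s. f (s, x)) has_real_derivative q (t, x)) (at t within {0..R})"
    and qg: "\<And>t x. t \<in> {0..R} \<Longrightarrow> \<bar>q (t, x)\<bar> \<le> g (t, x)"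
    and h0: "\<And>t x. t \<in> {0..R} \<Longrightarrow> 0 \<le> h (t, x)"
    and hg: "\<And>t x. t \<in> {0..R} \<Longrightarrow> h (t, x) \<le> E * g (t, x)"
    and slice: "\<And>t. t \<in> {0..R} \<Longrightarrow> \<exists>c. (\<integral>\<^sup>+x\<in>F. ennreal (\<bar>f (t, x) - c\<bar> powr p) \<partial>lborel)
        \<le> ennreal (C powr p) * (\<integral>\<^sup>+x\<in>F. ennreal (h (t, x) powr p) \<partial>lborel)"
  shows "\<exists>c. (\<integral>\<^sup>+z\<in>{0..R} \<times> F. ennreal (\<bar>f z - c\<bar> powr p * exp (m * fst z)) \<partial>lborel)
      \<le> ennreal ((p / m + (1 / (1 - exp (- 1 / 2))) powr (1 / p) * C * E) powr p)
        * (\<integral>\<^sup>+z\<in>{0..R} \<times> F. ennreal (g z powr p * exp (m * fst z)) \<partial>lborel)"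
proof -
  let ?B = "{0..R} \<times> F"
  define K where "K = (\<integral>\<^sup>+z\<in>?B. ennreal (g z powr p * exp (m * fst z)) \<partial>lborel)"
  define A :: real where "A = 1 / (1 - exp (- 1 / 2))"
  have A: "0 < A" "1 \<le> A" by (simp_all add: A_def field_simps)
  define \<alpha> \<beta> where "\<alpha> = p / m" and "\<beta> = A powr (1 / p) * C * E"
  have \<alpha>: "0 < \<alpha>" and \<beta>: "0 < \<beta>" using p m A C E by (simp_all add: \<alpha>_def \<beta>_def)
  have \<beta>p: "\<beta> powr p = A * C powr p * E powr p"
    using p A C E by (simp add: \<beta>_def powr_mult powr_powr)
  have g0: "0 \<le> g (t, x)" if "t \<in> {0..R}" for t x
    using qg[OF that, of x] by linarith
  have "\<exists>c. (\<integral>\<^sup>+z\<in>?B. ennreal (\<bar>f z - c\<bar> powr p * exp (m * fst z)) \<partial>lborel) \<le> ennreal ((\<alpha> + \<beta>) powr p) * K"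
  proof (cases "K = \<infinity>")
    case True
    then show ?thesis using \<alpha> \<beta> by (simp add: ennreal_mult_top)
  next
    case False
    define a where "a = max 0 (R - 1 / (2 * m))"
    have a: "0 \<le> a" "a < R" "R \<le> a + 1 / (2 * m)" using R m by (auto simp: a_def)
    define V W where "V = (exp (m * R) - 1) / m" and "W = (exp (m * R) - exp (m * a)) / m"
    have V: "(\<integral>\<^sup>+t\<in>{0..R}. ennreal (exp (m * t)) \<partial>lborel) = ennreal V"
      using nn_integral_exp_Icc[of m 0 R] m R by (simp add: V_def)
    have W: "(\<integral>\<^sup>+t\<in>{a..R}. ennreal (exp (m * t)) \<partial>lborel) = ennreal W"
      using nn_integral_exp_Icc[of m a R] m a by (simp add: W_def)
    have W0: "0 < W" using m a by (simp add: W_def)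
    \<comment> \<open>The collar \<open>[a, R]\<close> carries a fixed fraction of the whole mass.\<close>
    have VW: "V \<le> A * W"
    proof (cases "R \<le> 1 / (2 * m)")
      case True
      then have "V = W" by (simp add: a_def V_def W_def)
      then show ?thesis using mult_right_mono[OF A(2), of W] W0 by simp
    next
      case False
      then have "m * a = m * R - 1 / 2" using m by (simp add: a_def field_simps)
      then have "exp (m * a) = exp (m * R) * exp (- 1 / 2)"
        by (simp flip: exp_add)
      then have "W = exp (m * R) * (1 - exp (- 1 / 2)) / m"
        by (simp add: W_def right_diff_distrib)
      then have "A * W = exp (m * R) / m" by (simp add: A_def)
      then show ?thesis using m by (simp add: V_def field_simps)
    qed
    define T where "T t = (\<integral>\<^sup>+x\<in>F. ennreal (h (t, x) powr p) \<partial>lborel)" for t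
    have hp: "continuous_on ({0..R} \<times> UNIV) (\<lambda>z. h z powr p)"
      using h h0 p by (intro continuous_on_powr' continuous_intros) auto
    have "(\<lambda>t. T t * indicator {0..R} t) \<in> borel_measurable borel"
      unfolding T_def by (rule nn_integral_Times_lborel(3)[OF measurable_slab[OF hp F]])
    then have "(\<lambda>t. T t * indicator {0..R} t * indicator {a..R} t) \<in> borel_measurable borel"
      by measurable
    also have "(\<lambda>t. T t * indicator {0..R} t * indicator {a..R} t) = (\<lambda>t. T t * indicator {a..R} t)"
      using a by (auto simp: fun_eq_iff indicator_def)
    finally have Tm: "(\<lambda>t. T t * indicator {a..R} t) \<in> borel_measurable borel" .
    have hK: "(\<integral>\<^sup>+t\<in>{a..R}. T t * ennreal (exp (m * t)) \<partial>lborel) \<le> ennreal (E powr p) * K"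
    proof -
      have hc: "continuous_on ({0..R} \<times> UNIV) (\<lambda>z. h z powr p * exp (m * fst z))"
        by (intro continuous_intros hp)
      have gc: "continuous_on ({0..R} \<times> UNIV) (\<lambda>z. g z powr p * exp (m * fst z))"
        using g g0 p by (intro continuous_intros continuous_on_powr') auto
      have "(\<integral>\<^sup>+t\<in>{a..R}. T t * ennreal (exp (m * t)) \<partial>lborel)
          \<le> (\<integral>\<^sup>+t\<in>{0..R}. (\<integral>\<^sup>+x\<in>F. ennreal (h (t, x) powr p * exp (m * fst (t, x))) \<partial>lborel) \<partial>lborel)"
      proof (rule nn_integral_mono)
        fix t
        show "T t * ennreal (exp (m * t)) * indicator {a..R} t
          \<le> (\<integral>\<^sup>+x\<in>F. ennreal (h (t, x) powr p * exp (m * fst (t, x))) \<partial>lborel) * indicator {0..R} t"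
        proof (cases "t \<in> {a..R}")
          case True
          then have t: "t \<in> {0..R}" using a by simp
          have "continuous_on UNIV (\<lambda>x. h (t, x) powr p)"
            using t by (intro continuous_on_compose2[OF hp] continuous_intros) auto
          then have "(\<lambda>x. ennreal (h (t, x) powr p) * indicator F x) \<in> borel_measurable lborel"
            using F by (auto dest!: borel_measurable_continuous_onI)
          then have "T t * ennreal (exp (m * t)) = (\<integral>\<^sup>+x. ennreal (h (t, x) powr p) * indicator F x * ennreal (exp (m * t)) \<partial>lborel)"
            unfolding T_def by (rule nn_integral_multc[symmetric])
          also have "\<dots> = (\<integral>\<^sup>+x\<in>F. ennreal (h (t, x) powr p * exp (m * fst (t, x))) \<partial>lborel)"
            by (intro nn_integral_cong) (simp add: ennreal_mult mult_ac)
          finally show ?thesis using t True by simp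
        qed simp
      qed
      also have "\<dots> = (\<integral>\<^sup>+z\<in>?B. ennreal (h z powr p * exp (m * fst z)) \<partial>lborel)"
        by (rule nn_integral_Times_lborel(1)[OF measurable_slab[OF hc F], symmetric])
      also have "\<dots> \<le> (\<integral>\<^sup>+z. ennreal (E powr p) * (ennreal (g z powr p * exp (m * fst z)) * indicator ?B z) \<partial>lborel)"
      proof (rule nn_integral_mono)
        fix z :: "real \<times> 'a"
        show "ennreal (h z powr p * exp (m * fst z)) * indicator ?B z
          \<le> ennreal (E powr p) * (ennreal (g z powr p * exp (m * fst z)) * indicator ?B z)"
        proof (cases "z \<in> ?B")
          case True
          then obtain t x where z: "z = (t, x)" "t \<in> {0..R}" by auto
          have "h z powr p \<le> (E * g z) powr p"
            using h0[OF z(2)] hg[OF z(2)] p unfolding z by (intro powr_mono2) auto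
          also have "\<dots> = E powr p * g z powr p"
            by (rule powr_mult)
          finally have "h z powr p * exp (m * fst z) \<le> E powr p * (g z powr p * exp (m * fst z))"
            by (simp add: mult.assoc[symmetric] mult_right_mono)
          then show ?thesis using True by (simp add: ennreal_mult'[symmetric] ennreal_leI)
        qed simp
      qed
      also have "\<dots> = ennreal (E powr p) * K"
        unfolding K_def using measurable_slab[OF gc F] by (intro nn_integral_cmult) simp
      finally show ?thesis .
    qed
    have fin: "(\<integral>\<^sup>+t\<in>{a..R}. T t * ennreal (exp (m * t)) \<partial>lborel) \<noteq> \<infinity>"
      using hK False by (auto simp: top_unique ennreal_mult_eq_top_iff)
    obtain r where r: "r \<in> {a..R}"
      and avg: "(\<integral>\<^sup>+t\<in>{a..R}. ennreal (exp (m * t)) \<partial>lborel) * T r \<le> (\<integral>\<^sup>+t\<in>{a..R}. T t * ennreal (exp (m * t)) \<partial>lborel)"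
    proof (rule exists_le_weighted_average[of "{a..R}" lborel T "\<lambda>t. exp (m * t)"])
      show "(\<integral>\<^sup>+t\<in>{a..R}. ennreal (exp (m * t)) \<partial>lborel) \<noteq> 0" "(\<integral>\<^sup>+t\<in>{a..R}. ennreal (exp (m * t)) \<partial>lborel) \<noteq> \<infinity>"
        unfolding W using W0 by auto
    qed (use Tm fin in auto)
    have WT: "ennreal W * T r \<le> ennreal (E powr p) * K"
      using avg hK unfolding W by (rule order_trans)
    have r': "r \<in> {0..R}" using r a by auto
    obtain c where c: "(\<integral>\<^sup>+x\<in>F. ennreal (\<bar>f (r, x) - c\<bar> powr p) \<partial>lborel) \<le> ennreal (C powr p) * T r"
      using slice[OF r'] unfolding T_def by blast
    define f1 f2 where "f1 z = f z - f (r, snd z)" and "f2 z = f (r, snd z) - c" for z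
    have f2c: "continuous_on ({0..R} \<times> UNIV) f2"
      unfolding f2_def using r' by (intro continuous_intros continuous_on_compose2[OF f]) auto
    have f1c: "continuous_on ({0..R} \<times> UNIV) f1"
      unfolding f1_def using r' by (intro continuous_intros f continuous_on_compose2[OF f]) auto
    have cont: "continuous_on ({0..R} \<times> UNIV) (\<lambda>z. \<bar>k z\<bar> powr p * exp (m * fst z))"
      if "continuous_on ({0..R} \<times> (UNIV :: 'a set)) k" for k
      using p that by (intro continuous_intros continuous_on_powr') auto
    note meas = measurable_slab[OF cont F]
    \<comment> \<open>Hardy's inequality on the lines \<open>[0, R] \<times> {x}\<close>\<close>
    have I1: "(\<integral>\<^sup>+z\<in>?B. ennreal (\<bar>f1 z\<bar> powr p * exp (m * fst z)) \<partial>lborel) \<le> ennreal (\<alpha> powr p) * K"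
    proof -
      have "(\<integral>\<^sup>+z\<in>?B. ennreal (\<bar>f1 z\<bar> powr p * exp (m * fst z)) \<partial>lborel)
          = (\<integral>\<^sup>+x\<in>F. (\<integral>\<^sup>+t\<in>{0..R}. ennreal (\<bar>f1 (t, x)\<bar> powr p * exp (m * fst (t, x))) \<partial>lborel) \<partial>lborel)"
        by (rule nn_integral_Times_lborel(2)[OF meas[OF f1c]])
      also have "\<dots> \<le> (\<integral>\<^sup>+x. ennreal (\<alpha> powr p) * ((\<integral>\<^sup>+t\<in>{0..R}. ennreal (\<bar>q (t, x)\<bar> powr p * exp (m * fst (t, x))) \<partial>lborel) * indicator F x) \<partial>lborel)"
      proof (rule nn_integral_mono)
        fix x
        have "(\<integral>\<^sup>+t\<in>{0..R}. ennreal (\<bar>f1 (t, x)\<bar> powr p * exp (m * t)) \<partial>lborel)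
          \<le> ennreal (\<alpha> powr p) * (\<integral>\<^sup>+t\<in>{0..R}. ennreal (\<bar>q (t, x)\<bar> powr p * exp (m * t)) \<partial>lborel)"
          unfolding \<alpha>_def
        proof (rule hardy_exponential_weight_nn_integral[OF p m])
          show "((\<lambda>s. f1 (s, x)) has_real_derivative q (t, x)) (at t within {0..R})" if "t \<in> {0..R}" for t
            unfolding f1_def by (auto intro!: derivative_eq_intros deriv[OF that])
          show "continuous_on {0..R} (\<lambda>t. q (t, x))"
            by (intro continuous_on_compose2[OF q] continuous_intros) auto
          show "f1 (r, x) = 0" by (simp add: f1_def)
        qed (use r r' a in auto)
        then show "(\<integral>\<^sup>+t\<in>{0..R}. ennreal (\<bar>f1 (t, x)\<bar> powr p * exp (m * fst (t, x))) \<partial>lborel) * indicator F x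
          \<le> ennreal (\<alpha> powr p) * ((\<integral>\<^sup>+t\<in>{0..R}. ennreal (\<bar>q (t, x)\<bar> powr p * exp (m * fst (t, x))) \<partial>lborel) * indicator F x)"
          by (simp add: mult_right_mono mult.assoc[symmetric])
      qed
      also have "\<dots> = ennreal (\<alpha> powr p) * (\<integral>\<^sup>+x\<in>F. (\<integral>\<^sup>+t\<in>{0..R}. ennreal (\<bar>q (t, x)\<bar> powr p * exp (m * fst (t, x))) \<partial>lborel) \<partial>lborel)"
        using nn_integral_Times_lborel(4)[OF meas[OF q]] by (intro nn_integral_cmult) simp
      also have "\<dots> = ennreal (\<alpha> powr p) * (\<integral>\<^sup>+z\<in>?B. ennreal (\<bar>q z\<bar> powr p * exp (m * fst z)) \<partial>lborel)"
        by (simp only: nn_integral_Times_lborel(2)[OF meas[OF q]])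
      also have "\<dots> \<le> ennreal (\<alpha> powr p) * K"
      proof (rule mult_left_mono)
        show "(\<integral>\<^sup>+z\<in>?B. ennreal (\<bar>q z\<bar> powr p * exp (m * fst z)) \<partial>lborel) \<le> K"
          unfolding K_def using p qg
          by (intro nn_integral_mono)
            (auto simp: indicator_def intro!: ennreal_leI mult_right_mono powr_mono2)
      qed simp
      finally show ?thesis .
    qed
    \<comment> \<open>The inequality on the slice \<open>r\<close>, integrated over all slices\<close>
    have I2: "(\<integral>\<^sup>+z\<in>?B. ennreal (\<bar>f2 z\<bar> powr p * exp (m * fst z)) \<partial>lborel) \<le> ennreal (\<beta> powr p) * K"
    proof -
      let ?J = "\<integral>\<^sup>+x\<in>F. ennreal (\<bar>f (r, x) - c\<bar> powr p) \<partial>lborel"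
      have "(\<integral>\<^sup>+z\<in>?B. ennreal (\<bar>f2 z\<bar> powr p * exp (m * fst z)) \<partial>lborel)
          = (\<integral>\<^sup>+t\<in>{0..R}. (\<integral>\<^sup>+x\<in>F. ennreal (\<bar>f2 (t, x)\<bar> powr p * exp (m * fst (t, x))) \<partial>lborel) \<partial>lborel)"
        by (rule nn_integral_Times_lborel(1)[OF meas[OF f2c]])
      also have "\<dots> = (\<integral>\<^sup>+t. ?J * (ennreal (exp (m * t)) * indicator {0..R} t) \<partial>lborel)"
      proof (rule nn_integral_cong)
        fix t
        have "continuous_on UNIV (\<lambda>x. \<bar>f (r, x) - c\<bar> powr p)"
          using r' p by (intro continuous_on_powr' continuous_intros continuous_on_compose2[OF f]) auto
        then have "(\<lambda>x. ennreal (\<bar>f (r, x) - c\<bar> powr p) * indicator F x) \<in> borel_measurable lborel"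
          using F by (auto dest!: borel_measurable_continuous_onI)
        then have "?J * ennreal (exp (m * t)) = (\<integral>\<^sup>+x. ennreal (\<bar>f (r, x) - c\<bar> powr p) * indicator F x * ennreal (exp (m * t)) \<partial>lborel)"
          by (rule nn_integral_multc[symmetric])
        also have "\<dots> = (\<integral>\<^sup>+x\<in>F. ennreal (\<bar>f2 (t, x)\<bar> powr p * exp (m * fst (t, x))) \<partial>lborel)"
          by (intro nn_integral_cong) (simp add: ennreal_mult mult_ac f2_def)
        finally show "(\<integral>\<^sup>+x\<in>F. ennreal (\<bar>f2 (t, x)\<bar> powr p * exp (m * fst (t, x))) \<partial>lborel) * indicator {0..R} t
          = ?J * (ennreal (exp (m * t)) * indicator {0..R} t)"
          by (simp add: mult.assoc[symmetric])
      qed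
      also have "\<dots> = ?J * ennreal V"
        unfolding V[symmetric] by (rule nn_integral_cmult) measurable
      also have "\<dots> \<le> (ennreal (C powr p) * T r) * ennreal (A * W)"
        using VW by (intro mult_mono c ennreal_leI) auto
      also have "\<dots> = ennreal (A * C powr p) * (ennreal W * T r)"
        using A W0 by (simp add: ennreal_mult mult_ac)
      also have "\<dots> \<le> ennreal (A * C powr p) * (ennreal (E powr p) * K)"
        by (intro mult_left_mono WT) auto
      also have "\<dots> = ennreal (\<beta> powr p) * K"
        unfolding \<beta>p using A by (simp add: ennreal_mult mult_ac)
      finally show ?thesis .
    qed
    \<comment> \<open>Minkowski's inequality: the powers of \<open>\<alpha>\<close> and \<open>\<beta>\<close> recombine to \<open>(\<alpha> + \<beta>)\<^sup>p\<close>.\<close>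
    let ?s = "(\<alpha> + \<beta>) powr (p - 1)"
    have "(\<integral>\<^sup>+z\<in>?B. ennreal (\<bar>f z - c\<bar> powr p * exp (m * fst z)) \<partial>lborel)
      \<le> (\<integral>\<^sup>+z. ennreal (?s * \<alpha> powr (1 - p)) * (ennreal (\<bar>f1 z\<bar> powr p * exp (m * fst z)) * indicator ?B z)
             + ennreal (?s * \<beta> powr (1 - p)) * (ennreal (\<bar>f2 z\<bar> powr p * exp (m * fst z)) * indicator ?B z) \<partial>lborel)"
    proof (rule nn_integral_mono)
      fix z :: "real \<times> 'a"
      have "\<bar>f z - c\<bar> powr p \<le> (\<bar>f1 z\<bar> + \<bar>f2 z\<bar>) powr p"
        using p by (intro powr_mono2) (auto simp: f1_def f2_def)
      also have "\<dots> \<le> ?s * (\<alpha> powr (1 - p) * \<bar>f1 z\<bar> powr p + \<beta> powr (1 - p) * \<bar>f2 z\<bar> powr p)"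
        using p \<alpha> \<beta> by (intro powr_add_le_weighted) auto
      finally have "\<bar>f z - c\<bar> powr p * exp (m * fst z)
        \<le> ?s * (\<alpha> powr (1 - p) * \<bar>f1 z\<bar> powr p + \<beta> powr (1 - p) * \<bar>f2 z\<bar> powr p) * exp (m * fst z)"
        by (rule mult_right_mono) simp
      also have "\<dots> = ?s * \<alpha> powr (1 - p) * (\<bar>f1 z\<bar> powr p * exp (m * fst z)) + ?s * \<beta> powr (1 - p) * (\<bar>f2 z\<bar> powr p * exp (m * fst z))"
        by (simp add: algebra_simps)
      finally show "ennreal (\<bar>f z - c\<bar> powr p * exp (m * fst z)) * indicator ?B z
        \<le> ennreal (?s * \<alpha> powr (1 - p)) * (ennreal (\<bar>f1 z\<bar> powr p * exp (m * fst z)) * indicator ?B z)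
         + ennreal (?s * \<beta> powr (1 - p)) * (ennreal (\<bar>f2 z\<bar> powr p * exp (m * fst z)) * indicator ?B z)"
        by (cases "z \<in> ?B") (simp_all flip: ennreal_mult' ennreal_plus add: ennreal_leI)
    qed
    also have "\<dots> = ennreal (?s * \<alpha> powr (1 - p)) * (\<integral>\<^sup>+z\<in>?B. ennreal (\<bar>f1 z\<bar> powr p * exp (m * fst z)) \<partial>lborel)
        + ennreal (?s * \<beta> powr (1 - p)) * (\<integral>\<^sup>+z\<in>?B. ennreal (\<bar>f2 z\<bar> powr p * exp (m * fst z)) \<partial>lborel)"
      using meas[OF f1c] meas[OF f2c] by (simp add: nn_integral_add nn_integral_cmult)
    also have "\<dots> \<le> ennreal (?s * \<alpha> powr (1 - p)) * (ennreal (\<alpha> powr p) * K) + ennreal (?s * \<beta> powr (1 - p)) * (ennreal (\<beta> powr p) * K)"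
      by (intro add_mono mult_left_mono I1 I2) auto
    also have "\<dots> = ennreal (?s * (\<alpha> powr (1 - p) * \<alpha> powr p) + ?s * (\<beta> powr (1 - p) * \<beta> powr p)) * K"
      by (simp add: ennreal_mult ennreal_plus distrib_left distrib_right mult_ac)
    also have "?s * (\<alpha> powr (1 - p) * \<alpha> powr p) + ?s * (\<beta> powr (1 - p) * \<beta> powr p) = (\<alpha> + \<beta>) powr p"
    proof -
      have "x powr (1 - p) * x powr p = x" if "0 < x" for x :: real
        using that by (simp flip: powr_add)
      then have "?s * (\<alpha> powr (1 - p) * \<alpha> powr p) + ?s * (\<beta> powr (1 - p) * \<beta> powr p) = ?s * (\<alpha> + \<beta>)"
        using \<alpha> \<beta> by (simp add: distrib_left)
      also have "\<dots> = (\<alpha> + \<beta>) powr p"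
        using \<alpha> \<beta> by (simp add: powr_diff)
      finally show ?thesis .
    qed
    finally show ?thesis by blast
  qed
  then show ?thesis unfolding K_def \<alpha>_def \<beta>_def A_def .
qed

section \<open>Gradients on the ball and on the torus\<close>

text \<open>
  The metric is diagonal, so the gradient divides each partial derivative by the corresponding
  coefficient. The derivative within the ball is unique up to the two boundary components,
  because each boundary point can be moved a little in every coordinate direction without leaving the ball.
\<close>

lemma grad_norm_ball_X:
  fixes f :: "real \<times> (real ^ 'n) \<Rightarrow> real"
  assumes R: "0 < R" and t: "t \<in> {0..R}"
    and L: "(f has_derivative L) (at (t, x) within {0..R} \<times> UNIV)"
  shows "grad_norm (ball_X \<mu> \<Gamma> F R) f (t, x)
    = sqrt ((L (1, 0))\<^sup>2 + (\<Sum>i\<in>UNIV. exp (- 2 * \<mu> i * t) * (L (0, axis i 1))\<^sup>2))"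
proof -
  let ?M = "ball_X \<mu> \<Gamma> F R"
  interpret L: bounded_linear L using L by (rule has_derivative_bounded_linear)
  have metric: "rmetric ?M (t, x) (a, v) (b, w) =
      a * b + (\<Sum>i\<in>UNIV. exp (2 * \<mu> i * t) * (v $ i) * (w $ i))" for a b v w
    by (simp add: ball_X_def space_X_def)
  have "f differentiable (at (t, x) within {0..R} \<times> UNIV)"
    using L by (auto simp: differentiable_def)
  then have "frechet_derivative f (at (t, x) within {0..R} \<times> UNIV) = L"
  proof (intro frechet_derivative_unique_within[OF _ L])
    fix i :: "real \<times> (real ^ 'n)" and e :: real
    assume i: "i \<in> Basis" and e: "0 < e"
    show "\<exists>d. 0 < \<bar>d\<bar> \<and> \<bar>d\<bar> < e \<and> (t, x) + d *\<^sub>R i \<in> {0..R} \<times> UNIV"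
    proof (cases "t < R")
      case True
      then show ?thesis using e t i
        by (intro exI[of _ "min (e / 2) (R - t)"]) (auto simp: Basis_prod_def)
    next
      case False
      then show ?thesis using e t i R
        by (intro exI[of _ "- min (e / 2) R"]) (auto simp: Basis_prod_def)
    qed
  qed (simp add: frechet_derivative_works)
  then have D: "frechet_derivative f (at (t, x) within cover ?M) = L"
    by (simp add: ball_X_def)
  define w where "w = (L (1, 0), \<chi> i. exp (- 2 * \<mu> i * t) * L (0, axis i 1))"
  have ee: "exp (2 * \<mu> i * t) * (exp (- 2 * \<mu> i * t) * y) = y" for i y
    by (simp flip: exp_add mult.assoc)
  have w: "rmetric ?M (t, x) w z = L z" for z
  proof -
    obtain a v where z: "z = (a, v)" by (cases z)
    have "v = (\<Sum>i\<in>UNIV. (v $ i) *\<^sub>R axis i 1)"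
      using basis_expansion[of v] by (simp add: scalar_mult_eq_scaleR)
    then have "z = a *\<^sub>R (1, 0) + (\<Sum>i\<in>UNIV. (v $ i) *\<^sub>R (0, axis i 1))"
      by (simp add: z prod_eq_iff fst_sum snd_sum)
    then have "L z = a * L (1, 0) + (\<Sum>i\<in>UNIV. (v $ i) * L (0, axis i 1))"
      by (simp only: L.add L.scaleR L.sum real_scaleR_def)
    then show ?thesis
      unfolding w_def z metric vec_lambda_beta ee by (simp add: mult.commute)
  qed
  have "riem_grad ?M f (t, x) = w"
    unfolding riem_grad_def D
  proof (rule the_equality)
    fix w' assume w': "\<forall>v. rmetric ?M (t, x) w' v = L v"
    obtain a v where av: "w' = (a, v)" by (cases w')
    have ax: "(\<Sum>i\<in>UNIV. exp (2 * \<mu> i * t) * y i * (axis j 1 $ i)) = exp (2 * \<mu> j * t) * y j" for j and y :: "'n \<Rightarrow> real"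
      by (simp add: axis_def if_distrib[of "\<lambda>z. _ * z"] cong: if_cong)
    have "a = L (1, 0)" using w'[rule_format, of "(1, 0)"] by (simp add: av metric)
    moreover have "v $ j = exp (- 2 * \<mu> j * t) * L (0, axis j 1)" for j
    proof -
      have "exp (2 * \<mu> j * t) * v $ j = L (0, axis j 1)"
        using w'[rule_format, of "(0, axis j 1)"] unfolding av metric ax by simp
      then show ?thesis by (simp add: exp_minus field_simps)
    qed
    ultimately show "w' = w" by (simp add: av w_def vec_eq_iff)
  qed (use w in auto)
  then have "grad_norm ?M f (t, x) = sqrt (L w)"
    by (simp add: grad_norm_def w)
  also have "L w = rmetric ?M (t, x) w w" by (simp add: w)
  also have "\<dots> = (L (1, 0))\<^sup>2 + (\<Sum>i\<in>UNIV. exp (- 2 * \<mu> i * t) * (L (0, axis i 1))\<^sup>2)"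
    unfolding w_def metric vec_lambda_beta ee
    by (simp add: power2_eq_square mult_ac)
  finally show ?thesis .
qed

lemma grad_norm_torus:
  fixes f :: "real ^ 'n \<Rightarrow> real"
  assumes L: "(f has_derivative L) (at x)"
  shows "grad_norm (torus \<Gamma> F) f x = sqrt (\<Sum>i\<in>UNIV. (L (axis i 1))\<^sup>2)"
proof -
  have D: "frechet_derivative f (at x) = L"
    using L by (rule frechet_derivative_at[symmetric])
  have B: "(Basis :: (real ^ 'n) set) = range (\<lambda>i. axis i 1)"
    by (auto simp: Basis_vec_def)
  let ?w = "\<Sum>b\<in>Basis. L b *\<^sub>R b"
  have "riem_grad (torus \<Gamma> F) f x = ?w"
    using riem_grad_torus[of f x] L D by (auto simp: differentiable_def)
  then have "grad_norm (torus \<Gamma> F) f x = sqrt (?w \<bullet> ?w)"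
    by (simp add: grad_norm_def torus_def)
  also have "?w \<bullet> ?w = (\<Sum>b\<in>Basis. ?w \<bullet> (L b *\<^sub>R b))"
    by (rule inner_sum_right)
  also have "\<dots> = (\<Sum>b\<in>Basis. (L b)\<^sup>2)"
    by (intro sum.cong) (simp_all add: power2_eq_square)
  also have "\<dots> = (\<Sum>i\<in>UNIV. (L (axis i 1))\<^sup>2)"
    unfolding B by (subst sum.reindex) (auto simp: inj_def axis_eq_axis)
  finally show ?thesis .
qed

lemma C1_fun_torus_slice:
  fixes f :: "real \<times> (real ^ 'n) \<Rightarrow> real"
  assumes f: "C1_fun (ball_X \<mu> \<Gamma> F R) f" and t: "t \<in> {0..R}"
  shows "C1_fun (torus \<Gamma> F) (\<lambda>x. f (t, x))"
proof -
  have inv: "f (z + \<gamma>) = f z" if "z \<in> {0..R} \<times> UNIV" "\<gamma> \<in> {0} \<times> \<Gamma>" for z \<gamma>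
    using f that by (auto simp: C1_fun_def ball_X_def space_X_def)
  obtain f' :: "real \<times> (real ^ 'n) \<Rightarrow> (real \<times> (real ^ 'n)) \<Rightarrow>\<^sub>L real"
    where f': "continuous_on ({0..R} \<times> UNIV) f'"
      "\<And>z. z \<in> {0..R} \<times> UNIV \<Longrightarrow> (f has_derivative blinfun_apply (f' z)) (at z within {0..R} \<times> UNIV)"
    using f by (auto simp: C1_fun_def ball_X_def)
  have "bounded_linear (\<lambda>v :: real ^ 'n. (0 :: real, v))"
    by (intro bounded_linear_Pair bounded_linear_zero bounded_linear_ident)
  then obtain J where J: "\<And>v. blinfun_apply J v = (0 :: real, v :: real ^ 'n)"
    by (metis bounded_linear_Blinfun_apply)
  show ?thesis
    unfolding C1_fun_def torus_def riem_quot.simps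
  proof (intro conjI exI ballI)
    show "f (t, x + \<gamma>) = f (t, x)" if "\<gamma> \<in> \<Gamma>" for x \<gamma>
      using inv[of "(t, x)" "(0, \<gamma>)"] t that by simp
    show "continuous_on UNIV (\<lambda>x. f' (t, x) o\<^sub>L J)"
      using t by (intro continuous_intros continuous_on_compose2[OF f'(1)]) auto
    fix x
    have "((\<lambda>x. f (t, x)) has_derivative (\<lambda>v. blinfun_apply (f' (t, x)) (0, v))) (at x within UNIV)"
      using t by (intro has_derivative_in_compose2[where g = f and t = "{0..R} \<times> UNIV" and f = "\<lambda>x. (t, x)" and g' = "\<lambda>z. blinfun_apply (f' z)"] f'(2))
        (auto intro!: derivative_eq_intros)
    moreover have "blinfun_apply (f' (t, x) o\<^sub>L J) = (\<lambda>v. blinfun_apply (f' (t, x)) (0, v))"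
      by (simp add: J fun_eq_iff)
    ultimately show "((\<lambda>x. f (t, x)) has_derivative blinfun_apply (f' (t, x) o\<^sub>L J)) (at x within UNIV)"
      by simp
  qed
qed

section \<open>Poincare constants\<close>

text \<open>
  Comparing \<open>p\<close>-th powers avoids roots and covers infinite norms: since \<open>C > 0\<close>, both sides hold
  if the right-hand integral is infinite, and both fail if only the left-hand one is.
\<close>

lemma Lp_norm_le_iff:
  assumes p: "1 \<le> p" and C: "0 < C"
  shows "Lp_norm p M u \<le> ennreal C * Lp_norm p N v \<longleftrightarrow>
    (\<integral>\<^sup>+x\<in>fdom M. ennreal (\<bar>u x\<bar> powr p * vol_density M x) \<partial>lborel)
      \<le> ennreal (C powr p) * (\<integral>\<^sup>+x\<in>fdom N. ennreal (\<bar>v x\<bar> powr p * vol_density N x) \<partial>lborel)"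
    (is "_ \<longleftrightarrow> ?I \<le> _ * ?J")
proof -
  have Lp: "Lp_norm p M u = (if ?I = \<infinity> then \<infinity> else ennreal (enn2real ?I powr (1 / p)))"
    "Lp_norm p N v = (if ?J = \<infinity> then \<infinity> else ennreal (enn2real ?J powr (1 / p)))"
    by (simp_all add: Lp_norm_def Let_def)
  show ?thesis
  proof (cases "?J = \<infinity>")
    case True
    then show ?thesis using C by (simp add: Lp ennreal_mult_top)
  next
    case J: False
    show ?thesis
    proof (cases "?I = \<infinity>")
      case True
      then show ?thesis using C J
        by (auto simp: Lp top_unique ennreal_mult_eq_top_iff)
    next
      case False
      then obtain a where a: "0 \<le> a" "?I = ennreal a" by (cases ?I) auto
      from J obtain b where b: "0 \<le> b" "?J = ennreal b" by (cases ?J) auto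
      have "(a powr (1 / p) \<le> C * b powr (1 / p)) \<longleftrightarrow> a \<le> C powr p * b"
      proof -
        have "C * b powr (1 / p) = (C powr p * b) powr (1 / p)"
          using p C b(1) by (simp add: powr_mult powr_powr)
        moreover have "a powr (1 / p) \<le> (C powr p * b) powr (1 / p) \<longleftrightarrow> a \<le> C powr p * b"
        proof
          assume "a powr (1 / p) \<le> (C powr p * b) powr (1 / p)"
          then have "(a powr (1 / p)) powr p \<le> ((C powr p * b) powr (1 / p)) powr p"
            using p by (intro powr_mono2[of p]) auto
          moreover have "0 \<le> C powr p * b" using b(1) by simp
          ultimately show "a \<le> C powr p * b"
            using p a(1) by (simp add: powr_powr)
        next
          assume "a \<le> C powr p * b"
          then show "a powr (1 / p) \<le> (C powr p * b) powr (1 / p)"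
            using p a(1) by (intro powr_mono2) auto
        qed
        ultimately show ?thesis by simp
      qed
      then show ?thesis
        using a b C by (simp add: Lp flip: ennreal_mult')
    qed
  qed
qed

text \<open>
  The metric along a slice \<open>{t} \<times> \<real>\<^sup>n\<close> expands lengths by at most \<open>e\<^bsup>\<nu> R\<^esup>\<close>, hence the Euclidean gradient of
  \<open>f(t, \<cdot>)\<close> is at most \<open>e\<^bsup>\<nu> R\<^esup>\<close> times the Riemannian one, and the slab inequality applies.
\<close>

lemma poincare_const_ball_X_le:
  fixes \<mu> :: "'n::finite \<Rightarrow> real"
  assumes \<mu>0: "\<And>i. 0 < \<mu> i" and \<nu>: "\<And>i. \<mu> i \<le> \<nu>" and p: "1 \<le> p" and R: "0 < R" and F: "F \<in> sets borel"
    and C: "0 < C"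
    and torus: "\<And>\<phi>. C1_fun (torus \<Gamma> F) \<phi> \<Longrightarrow>
      \<exists>c. Lp_norm p (torus \<Gamma> F) (\<lambda>x. \<phi> x - c) \<le> ennreal C * Lp_norm p (torus \<Gamma> F) (grad_norm (torus \<Gamma> F) \<phi>)"
  shows "poincare_const p (ball_X \<mu> \<Gamma> F R)
    \<le> ennreal (p / (\<Sum>i\<in>UNIV. \<mu> i) + (1 / (1 - exp (- 1 / 2))) powr (1 / p) * C * exp (\<nu> * R))"
    (is "_ \<le> ennreal ?C")
proof -
  let ?M = "ball_X \<mu> \<Gamma> F R" and ?T = "torus \<Gamma> F"
  let ?S = "{0..R} \<times> (UNIV :: (real ^ 'n) set)"
  let ?m = "\<Sum>i\<in>UNIV. \<mu> i" and ?E = "exp (\<nu> * R)"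
  have m: "0 < ?m" using \<mu>0 by (intro sum_pos) auto
  have C': "0 < ?C" using m p C by (intro add_pos_nonneg) auto
  have "\<exists>c. Lp_norm p ?M (\<lambda>z. f z - c) \<le> ennreal ?C * Lp_norm p ?M (grad_norm ?M f)"
    if f: "C1_fun ?M f" for f
  proof -
    obtain f' :: "real \<times> (real ^ 'n) \<Rightarrow> (real \<times> (real ^ 'n)) \<Rightarrow>\<^sub>L real"
      where f'c: "continuous_on ?S f'"
        and f': "\<And>z. z \<in> ?S \<Longrightarrow> (f has_derivative blinfun_apply (f' z)) (at z within ?S)"
      using f by (auto simp: C1_fun_def ball_X_def)
    define q where "q z = blinfun_apply (f' z) (1, 0)" for z
    define d where "d i z = blinfun_apply (f' z) (0, axis i 1)" for i z
    define g where "g z = sqrt ((q z)\<^sup>2 + (\<Sum>i\<in>UNIV. exp (- 2 * \<mu> i * fst z) * (d i z)\<^sup>2))" for z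
    define h where "h z = sqrt (\<Sum>i\<in>UNIV. (d i z)\<^sup>2)" for z
    have qc: "continuous_on ?S q" and dc: "continuous_on ?S (d i)" for i
      unfolding q_def d_def by (intro continuous_intros f'c)+
    have fc: "continuous_on ?S f"
      using f' by (meson has_derivative_continuous_on)
    have gM: "grad_norm ?M f (t, x) = g (t, x)" if "t \<in> {0..R}" for t x
      using grad_norm_ball_X[OF R that f'] that by (simp add: g_def q_def d_def)
    have sliced: "((\<lambda>x. f (t, x)) has_derivative (\<lambda>v. blinfun_apply (f' (t, x)) (0, v))) (at x)" if "t \<in> {0..R}" for t x
      using that by (intro has_derivative_in_compose2[where g = f and t = ?S and f = "\<lambda>x. (t, x)" and g' = "\<lambda>z. blinfun_apply (f' z)"] f')
        (auto intro!: derivative_eq_intros)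
    have hT: "grad_norm ?T (\<lambda>x. f (t, x)) x = h (t, x)" if "t \<in> {0..R}" for t x
      using grad_norm_torus[OF sliced[OF that]] by (simp add: h_def d_def)
    have h_abs: "\<bar>h z\<bar> = h z" for z
      by (simp add: h_def sum_nonneg)
    have "\<exists>c. (\<integral>\<^sup>+z\<in>{0..R} \<times> F. ennreal (\<bar>f z - c\<bar> powr p * exp (?m * fst z)) \<partial>lborel)
      \<le> ennreal (?C powr p) * (\<integral>\<^sup>+z\<in>{0..R} \<times> F. ennreal (g z powr p * exp (?m * fst z)) \<partial>lborel)"
    proof (rule poincare_slab[OF p m R _ C F fc qc])
      show "continuous_on ?S g" "continuous_on ?S h"
        unfolding g_def h_def by (intro continuous_intros qc dc)+
      fix t x assume t: "t \<in> {0..R}"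
      have "((\<lambda>s. f (s, x)) has_derivative (\<lambda>s. blinfun_apply (f' (t, x)) (s, 0))) (at t within {0..R})"
        using t by (intro has_derivative_in_compose2[where g = f and t = ?S and f = "\<lambda>s. (s, x)" and g' = "\<lambda>z. blinfun_apply (f' z)"] f')
          (auto intro!: derivative_eq_intros)
      moreover have "blinfun_apply (f' (t, x)) (s, 0) = q (t, x) * s" for s
        using blinfun.scaleR_right[of "f' (t, x)" s "(1, 0)"] by (simp add: q_def)
      ultimately show "((\<lambda>s. f (s, x)) has_real_derivative q (t, x)) (at t within {0..R})"
        by (simp add: has_field_derivative_def)
      show "\<bar>q (t, x)\<bar> \<le> g (t, x)"
        unfolding g_def by (intro real_le_rsqrt) (simp add: sum_nonneg)
      show "0 \<le> h (t, x)" by (simp add: h_def sum_nonneg)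
      show "h (t, x) \<le> ?E * g (t, x)"
      proof -
        have "(\<Sum>i\<in>UNIV. (d i (t, x))\<^sup>2) \<le> (\<Sum>i\<in>UNIV. ?E\<^sup>2 * (exp (- 2 * \<mu> i * t) * (d i (t, x))\<^sup>2))"
        proof (rule sum_mono)
          fix i
          have "\<mu> i * t \<le> \<nu> * R"
            using t \<mu>0[of i] \<nu>[of i] by (intro mult_mono) auto
          then have "1 \<le> ?E\<^sup>2 * exp (- 2 * \<mu> i * t)"
            by (simp add: power2_eq_square mult.commute flip: exp_add)
          from mult_right_mono[OF this, of "(d i (t, x))\<^sup>2"]
          show "(d i (t, x))\<^sup>2 \<le> ?E\<^sup>2 * (exp (- 2 * \<mu> i * t) * (d i (t, x))\<^sup>2)"
            by (simp add: mult.assoc)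
        qed
        also have "\<dots> \<le> ?E\<^sup>2 * ((q (t, x))\<^sup>2 + (\<Sum>i\<in>UNIV. exp (- 2 * \<mu> i * t) * (d i (t, x))\<^sup>2))"
          by (simp add: sum_distrib_left[symmetric])
        finally have "h (t, x) \<le> sqrt (?E\<^sup>2 * ((q (t, x))\<^sup>2 + (\<Sum>i\<in>UNIV. exp (- 2 * \<mu> i * t) * (d i (t, x))\<^sup>2)))"
          unfolding h_def by (rule real_sqrt_le_mono)
        then show ?thesis by (simp add: g_def real_sqrt_mult)
      qed
      obtain c where "Lp_norm p ?T (\<lambda>x. f (t, x) - c) \<le> ennreal C * Lp_norm p ?T (grad_norm ?T (\<lambda>x. f (t, x)))"
        using torus[OF C1_fun_torus_slice[OF f t]] by blast
      then have "(\<integral>\<^sup>+x\<in>F. ennreal (\<bar>f (t, x) - c\<bar> powr p) \<partial>lborel)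
        \<le> ennreal (C powr p) * (\<integral>\<^sup>+x\<in>F. ennreal (h (t, x) powr p) \<partial>lborel)"
        unfolding Lp_norm_le_iff[OF p C]
        by (simp add: vol_density_torus hT[OF t] h_abs torus_def[THEN arg_cong, of fdom])
      then show "\<exists>c. (\<integral>\<^sup>+x\<in>F. ennreal (\<bar>f (t, x) - c\<bar> powr p) \<partial>lborel)
        \<le> ennreal (C powr p) * (\<integral>\<^sup>+x\<in>F. ennreal (h (t, x) powr p) \<partial>lborel)" by blast
    qed simp
    then obtain c where c: "(\<integral>\<^sup>+z\<in>{0..R} \<times> F. ennreal (\<bar>f z - c\<bar> powr p * exp (?m * fst z)) \<partial>lborel)
      \<le> ennreal (?C powr p) * (\<integral>\<^sup>+z\<in>{0..R} \<times> F. ennreal (g z powr p * exp (?m * fst z)) \<partial>lborel)" by blast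
    have fd: "fdom ?M = {0..R} \<times> F" by (simp add: ball_X_def)
    have vd: "vol_density ?M z = exp (?m * fst z)" for z
      by (cases z) (simp add: vol_density_ball_X)
    have eq: "(\<integral>\<^sup>+z\<in>{0..R} \<times> F. ennreal (\<bar>grad_norm ?M f z\<bar> powr p * exp (?m * fst z)) \<partial>lborel)
      = (\<integral>\<^sup>+z\<in>{0..R} \<times> F. ennreal (g z powr p * exp (?m * fst z)) \<partial>lborel)"
      by (intro nn_integral_cong) (auto simp: indicator_def gM g_def sum_nonneg)
    show ?thesis
      unfolding Lp_norm_le_iff[OF p C'] fd vd eq using c by blast
  qed
  then show ?thesis
    unfolding poincare_const_def by (intro Inf_lower) blast
qed

theorem theorem3:
  fixes \<mu> :: "'n::{finite,linorder} \<Rightarrow> real"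
  assumes "\<And>i. 0 < \<mu> i" and "mono \<mu>"
  shows "\<exists>A::real. A > 0 \<and>
    (\<forall>p \<Gamma> F R. p \<ge> 1 \<and> lattice_in \<Gamma> \<and> fundamental_domain \<Gamma> F \<and> R > 0 \<longrightarrow>
       poincare_const p (ball_X \<mu> \<Gamma> F R)
         \<le> ennreal (p / (\<Sum>i\<in>UNIV. \<mu> i))
           + ennreal (A powr (1 / p)) * poincare_const p (torus \<Gamma> F)
             * ennreal (exp (\<mu> (Max UNIV) * R)))"
proof (intro exI[of _ "1 / (1 - exp (- 1 / 2))"] conjI allI impI)
  let ?A = "1 / (1 - exp (- 1 / 2)) :: real"
  show "?A > 0" by simp
  fix p :: real and \<Gamma> F :: "(real, 'n) vec set" and R :: real
  assume asm: "p \<ge> 1 \<and> lattice_in \<Gamma> \<and> fundamental_domain \<Gamma> F \<and> R > 0"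
  then have F: "F \<in> sets borel" by (simp add: fundamental_domain_def)
  let ?P = "poincare_const p (torus \<Gamma> F)" and ?Q = "poincare_const p (ball_X \<mu> \<Gamma> F R)"
  let ?m = "\<Sum>i\<in>UNIV. \<mu> i" and ?E = "exp (\<mu> (Max UNIV) * R)"
  have m: "0 < ?m" using assms by (intro sum_pos) auto
  show "?Q \<le> ennreal (p / ?m) + ennreal (?A powr (1 / p)) * ?P * ennreal ?E"
  proof (cases "?P = \<infinity>")
    case True
    then show ?thesis by (simp add: ennreal_mult_top ennreal_top_mult)
  next
    case False
    then obtain C0 where C0: "0 \<le> C0" "?P = ennreal C0" by (cases ?P) auto
    have le: "?Q \<le> ennreal (p / ?m + ?A powr (1 / p) * C * ?E)" if C: "C0 < C" for C
    proof (rule poincare_const_ball_X_le)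
      fix \<phi> assume \<phi>: "C1_fun (torus \<Gamma> F) \<phi>"
      have "?P < ennreal C" using C C0 by (simp add: ennreal_less_iff)
      then obtain D where D: "D < ennreal C" "\<forall>f. C1_fun (torus \<Gamma> F) f \<longrightarrow>
            (\<exists>c::real. Lp_norm p (torus \<Gamma> F) (\<lambda>x. f x - c) \<le> D * Lp_norm p (torus \<Gamma> F) (grad_norm (torus \<Gamma> F) f))"
        unfolding poincare_const_def Inf_less_iff by blast
      with \<phi> obtain c where "Lp_norm p (torus \<Gamma> F) (\<lambda>x. \<phi> x - c) \<le> D * Lp_norm p (torus \<Gamma> F) (grad_norm (torus \<Gamma> F) \<phi>)"
        by blast
      also have "\<dots> \<le> ennreal C * Lp_norm p (torus \<Gamma> F) (grad_norm (torus \<Gamma> F) \<phi>)"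
        using D by (intro mult_right_mono) auto
      finally show "\<exists>c. Lp_norm p (torus \<Gamma> F) (\<lambda>x. \<phi> x - c) \<le> ennreal C * Lp_norm p (torus \<Gamma> F) (grad_norm (torus \<Gamma> F) \<phi>)" ..
    qed (use assms asm F C C0 in \<open>auto simp: monoD\<close>)
    \<comment> \<open>The torus constant is an infimum that need not be attained: let \<open>C\<close> decrease to it.\<close>
    have "?Q \<le> ennreal (p / ?m + ?A powr (1 / p) * C0 * ?E)"
    proof (rule tendsto_lowerbound)
      show "((\<lambda>C. ennreal (p / ?m + ?A powr (1 / p) * C * ?E)) \<longlongrightarrow> ennreal (p / ?m + ?A powr (1 / p) * C0 * ?E)) (at_right C0)"
        by (intro tendsto_ennrealI tendsto_intros)
      show "\<forall>\<^sub>F C in at_right C0. ?Q \<le> ennreal (p / ?m + ?A powr (1 / p) * C * ?E)"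
        using le by (intro eventually_mono[OF eventually_at_right_less])
    qed simp
    also have "\<dots> = ennreal (p / ?m) + ennreal (?A powr (1 / p)) * ?P * ennreal ?E"
      using C0 m asm by (simp add: ennreal_mult ennreal_plus)
    finally show ?thesis .
  qed
qed

end
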